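(* Let $0\le m\le n$ be integers and let $K_m(x,y)=K_m(x_1,\dots,x_m,y_1,\dots,y_m)$ be the multivariable Christoffel--Darboux kernel associated with the given linear functional. Writing $(z_1,\dots,z_{2m})=(x_1,\dots,x_m,y_1,\dots,y_m)$, the polynomial $K_m(z)=K_m(z_1,\dots,z_{2m})$ is symmetric in all its $2m$ variables.
   Context: Scalars are complex. Let $f\mapsto\int f(x)\,d\mu(x)$ be a linear functional on polynomials in one variable. For $n\ge1$ let $V_n$ be the space of one-variable polynomials of degree at most $n-1$, and assume that the bilinear pairing $\langle f,g\rangle=\int f(x)g(x)\,d\mu(x)$ is non-degenerate on each $V_n$. Let $(p_k)_{k\ge0}$ be the corresponding monic orthogonal polynomials ($\deg p_k=k$). Let $K(x,y)=\sum_{k=0}^{n-1}\frac{p_k(x)p_k(y)}{\langle p_k,p_k\rangle}$ (depending on $n$). For $x=(x_1,\dots,x_m)$ put $\Delta(x)=\prod_{1\le i<j\le m}(x_j-x_i)$. Let $V_n^m$ ($0\le m\le n$) be the space of antisymmetric polynomials in $x_1,\dots,x_m$ of degree at most $n-1$ in each $x_i$. Write $\int f(x)\,d\mu_m(x)=\frac1{m!}\int f(x_1,\dots,x_m)\,d\mu(x_1)\cdots d\mu(x_m)$, where the functional is applied in each variable separately. The kernel $K_m(x,y)$ is defined by requiring that $\Delta(x)\Delta(y)K_m(x,y)$ be the reproducing kernel of $V_n^m$, i.e. the unique element of $V_n^m\otimes V_n^m$ such that $f(x)=\int f(y)\Delta(x)\Delta(y)K_m(x,y)\,d\mu_m(y)$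 for all $f\in V_n^m$. Equivalently, $K_m(x,y)=\frac{\det_{1\le i,j\le m}(K(x_i,y_j))}{\Delta(x)\Delta(y)}$, which is a polynomial. Empty products and determinants equal $1$. *)

theory Defs
  imports
    Complex_Main
    "HOL-Computational_Algebra.Polynomial"
    "HOL-Combinatorics.Permutations"
    "HOL-Library.Poly_Mapping"
begin

section \<open>Multivariate complex polynomials\<close>

text \<open>
  A multivariate polynomial is a finitely supported map from exponent vectors to coefficients;
  the multiplication of this type is the convolution product, so it is the polynomial ring
  over the complex numbers in the variables with indices 0, 1, 2, ...
\<close>

type_synonym cmpoly = "(nat \<Rightarrow>\<^sub>0 nat) \<Rightarrow>\<^sub>0 complex"

definition mconst :: "complex \<Rightarrow> cmpoly" where
  "mconst c = Poly_Mapping.single 0 c"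

definition mvar :: "nat \<Rightarrow> cmpoly" where
  "mvar i = Poly_Mapping.single (Poly_Mapping.single i 1) 1"

definition mvars :: "cmpoly \<Rightarrow> nat set" where
  "mvars p = (\<Union>\<alpha>\<in>Poly_Mapping.keys p. Poly_Mapping.keys \<alpha>)"

definition rename_vars :: "(nat \<Rightarrow> nat) \<Rightarrow> cmpoly \<Rightarrow> cmpoly" where
  "rename_vars \<sigma> p =
     (\<Sum>\<alpha>\<in>Poly_Mapping.keys p. mconst (Poly_Mapping.lookup p \<alpha>) *
        (\<Prod>i\<in>Poly_Mapping.keys \<alpha>. mvar (\<sigma> i) ^ Poly_Mapping.lookup \<alpha> i))"

definition symmetric_in :: "nat \<Rightarrow> cmpoly \<Rightarrow> bool" where
  "symmetric_in k p \<longleftrightarrow> (\<forall>\<sigma>. \<sigma> permutes {..<k} \<longrightarrow> rename_vars \<sigma> p = p)"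

definition antisymmetric_in :: "nat \<Rightarrow> cmpoly \<Rightarrow> bool" where
  "antisymmetric_in k p \<longleftrightarrow>
     (\<forall>\<sigma>. \<sigma> permutes {..<k} \<longrightarrow> rename_vars \<sigma> p = of_int (sign \<sigma>) * p)"


section \<open>The linear functional and its multivariable version\<close>

definition nondegenerate_pairing :: "(complex poly \<Rightarrow> complex) \<Rightarrow> bool" where
  "nondegenerate_pairing L \<longleftrightarrow>
     (\<forall>n\<ge>1. \<forall>f. degree f \<le> n - 1 \<and> (\<forall>g. degree g \<le> n - 1 \<longrightarrow> L (f * g) = 0) \<longrightarrow> f = 0)"

text \<open>
  Applying \<open>L\<close> in the variable with index \<open>i\<close> replaces the factor $x_i^k$ of each monomial
  by the number \<open>L\<close> assigns to the one-variable monomial of degree \<open>k\<close>.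
\<close>

definition int_var :: "(complex poly \<Rightarrow> complex) \<Rightarrow> nat \<Rightarrow> cmpoly \<Rightarrow> cmpoly" where
  "int_var L i p =
     (\<Sum>\<alpha>\<in>Poly_Mapping.keys p.
        Poly_Mapping.single (Poly_Mapping.update i 0 \<alpha>)
          (Poly_Mapping.lookup p \<alpha> * L (monom 1 (Poly_Mapping.lookup \<alpha> i))))"


section \<open>The multivariable Christoffel--Darboux kernel\<close>

text \<open>
  In a polynomial in \<open>x\<close> and \<open>y\<close>, the variables of \<open>x\<close> have the indices \<open>0, ..., m - 1\<close>
  and the variables of \<open>y\<close> have the indices \<open>m, ..., 2 * m - 1\<close>.
\<close>

definition in_y :: "nat \<Rightarrow> cmpoly \<Rightarrow> cmpoly" where
  "in_y m f = rename_vars (\<lambda>i. m + i) f"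

definition int_y :: "(complex poly \<Rightarrow> complex) \<Rightarrow> nat \<Rightarrow> cmpoly \<Rightarrow> cmpoly" where
  "int_y L m F = mconst (1 / fact m) * fold (int_var L) [m..<2 * m] F"

definition vandermonde :: "nat \<Rightarrow> cmpoly" where
  "vandermonde m = (\<Prod>j<m. \<Prod>i<j. mvar j - mvar i)"

text \<open>
  Degree at most \<open>n - 1\<close> is written as \<open>< n\<close>, which avoids truncated subtraction.
\<close>

definition antisym_space :: "nat \<Rightarrow> nat \<Rightarrow> cmpoly set" where
  "antisym_space n m =
     {f. mvars f \<subseteq> {..<m} \<and> antisymmetric_in m f \<and>
         (\<forall>\<alpha>\<in>Poly_Mapping.keys f. \<forall>i<m. Poly_Mapping.lookup \<alpha> i < n)}"

text \<open>The tensor square of \<open>antisym_space n m\<close>, inside the polynomials in \<open>x\<close> and \<open>y\<close>.\<close>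

definition antisym_tensor :: "nat \<Rightarrow> nat \<Rightarrow> cmpoly set" where
  "antisym_tensor n m =
     {(\<Sum>k<N. f k * in_y m (g k)) | (N :: nat) f g.
        \<forall>k<N. f k \<in> antisym_space n m \<and> g k \<in> antisym_space n m}"

definition is_reproducing_kernel ::
    "(complex poly \<Rightarrow> complex) \<Rightarrow> nat \<Rightarrow> nat \<Rightarrow> cmpoly \<Rightarrow> bool" where
  "is_reproducing_kernel L n m R \<longleftrightarrow>
     R \<in> antisym_tensor n m \<and>
     (\<forall>f\<in>antisym_space n m. f = int_y L m (in_y m f * R))"

text \<open>
  If the pairing is nondegenerate and \<open>m \<le> n\<close>, the reproducing kernel exists and is unique and
  is divisible by the product of the two Vandermonde factors; since the polynomial ring is an
  integral domain, the description below then determines a unique polynomial. \<close>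

definition CD_kernel :: "(complex poly \<Rightarrow> complex) \<Rightarrow> nat \<Rightarrow> nat \<Rightarrow> cmpoly" where
  "CD_kernel L n m =
     (THE K. mvars K \<subseteq> {..<2 * m} \<and>
        is_reproducing_kernel L n m (vandermonde m * in_y m (vandermonde m) * K))"

end

theory Submission
  imports Defs "Jordan_Normal_Form.Determinant"
begin

text \<open>
  The symmetry becomes visible once the kernel is written as an integral over \<open>n - m\<close> additional
  variables \<open>w\<close>. Up to a nonzero constant,

    \<open>K\<^sub>m(z) = \<integral> \<Delta>(w)\<^sup>2 \<Prod>\<^sub>j \<Prod>\<^sub>i (w\<^sub>j - z\<^sub>i) d\<mu>(w)\<close>,

  where \<open>i\<close> runs over all \<open>2 * m\<close> variables \<open>z = (x, y)\<close> (theorem \<open>CD_kernel_eq_integral\<close>). The right-hand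
  side is evidently unchanged when the \<open>z\<^sub>i\<close> are permuted.

  To prove the formula, multiply it by \<open>\<Delta>(x) \<Delta>(y)\<close>. The integrand becomes \<open>\<Delta>(x, w) \<Delta>(y, w)\<close>, a product
  of two Vandermonde determinants of size \<open>n\<close> (lemma \<open>vandermonde_product_factorization\<close>). Row
  operations allow the powers in these determinants to be replaced by the monic orthogonal polynomials
  \<open>p\<^sub>0, ..., p\<^sub>n\<^sub>-\<^sub>1\<close> (lemma \<open>vandermonde_product_eq_det\<close>), and expanding them over permutations makes
  the integral over \<open>w\<close> a matter of orthogonality. The result is, up to normalization,

    \<open>\<Sum>\<^sub>\<tau> H\<^sub>\<tau> A\<^sub>\<tau>(x) \<Prod>\<^sub>b p\<^sub>\<tau>\<^sub>b(y\<^sub>b)\<close>,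

  a sum over the permutations \<open>\<tau>\<close> of \<open>{0, ..., n - 1}\<close>, where \<open>A\<^sub>\<tau>\<close> is the antisymmetrization of
  \<open>\<Prod>\<^sub>b p\<^sub>\<tau>\<^sub>b(x\<^sub>b)\<close>, the index \<open>b\<close> runs through \<open>{0, ..., m - 1}\<close>, and \<open>H\<^sub>\<tau>\<close> is a product of squared norms
  (lemma \<open>integrated_vandermonde_product\<close>). Using orthogonality once more, now in \<open>y\<close>, one sees that
  this element of \<open>V\<^sub>n\<^sup>m \<otimes> V\<^sub>n\<^sup>m\<close> reproduces every antisymmetric polynomial up to the constant
  \<open>h\<^sub>0 \<dots> h\<^sub>n\<^sub>-\<^sub>1 (n - m)!\<close> with \<open>h\<^sub>k = L (p\<^sub>k p\<^sub>k)\<close> (lemma \<open>int_y_reproducing_sum\<close>).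
  Nondegeneracy makes all \<open>h\<^sub>k\<close> nonzero, so the constant can be divided out.

  It remains to know that the conditions that define \<open>K\<^sub>m\<close> have only one solution. Any two reproducing
  kernels are transposes of each other, and therefore equal (lemma \<open>reproducing_kernel_unique\<close>).
\<close>

(* Throughout, smult is scalar multiplication of univariate polynomials, not of modules. *)
hide_const (open) Module.smult

section \<open>Constants, variables and renaming\<close>

text \<open>
  Additive operations such as \<open>rename_vars\<close> and \<open>int_var\<close> are determined by their values on
  monomials; rewriting with this identity reduces statements about them to that case.
\<close>

lemma cmpoly_as_sum: "(\<Sum>\<alpha>\<in>Poly_Mapping.keys p. Poly_Mapping.single \<alpha> (Poly_Mapping.lookup p \<alpha>)) = (p :: cmpoly)"
proof (rule poly_mapping_eqI)
  fix \<beta>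
  have "Poly_Mapping.lookup (\<Sum>\<alpha>\<in>Poly_Mapping.keys p. Poly_Mapping.single \<alpha> (Poly_Mapping.lookup p \<alpha>)) \<beta>
      = (\<Sum>\<alpha>\<in>Poly_Mapping.keys p. if \<beta> = \<alpha> then Poly_Mapping.lookup p \<alpha> else 0)"
    by (auto simp: lookup_sum lookup_single when_def intro!: sum.cong)
  also have "\<dots> = Poly_Mapping.lookup p \<beta>"
    by (auto simp: in_keys_iff)
  finally show "Poly_Mapping.lookup (\<Sum>\<alpha>\<in>Poly_Mapping.keys p. Poly_Mapping.single \<alpha> (Poly_Mapping.lookup p \<alpha>)) \<beta> = Poly_Mapping.lookup p \<beta>" .
qed

lemma mconst_add: "mconst (a + b) = mconst a + mconst b"
  and mconst_mult: "mconst (a * b) = mconst a * mconst b"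
  and mconst_0 [simp]: "mconst 0 = 0"
  and mconst_1 [simp]: "mconst 1 = 1"
  and mconst_of_int: "mconst (of_int k) = of_int k"
  and mconst_of_nat: "mconst (of_nat l) = of_nat l"
  by (simp_all add: mconst_def single_add mult_single flip: single_of_int single_of_nat)

lemma mconst_sum: "mconst (sum f A) = (\<Sum>x\<in>A. mconst (f x))"
  by (induction A rule: infinite_finite_induct) (auto simp: mconst_add)

lemma mconst_prod: "mconst (prod f A) = (\<Prod>x\<in>A. mconst (f x))"
  by (induction A rule: infinite_finite_induct) (auto simp: mconst_mult)

lemma mconst_mult_single: "mconst c * Poly_Mapping.single \<alpha> d = Poly_Mapping.single \<alpha> (c * d)"
  by (simp add: mconst_def mult_single)

lemma mvar_power: "mvar i ^ k = Poly_Mapping.single (Poly_Mapping.single i k) 1"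
  by (induction k) (auto simp: mvar_def mult_single simp flip: single_add)

lemma keys_mconst_mult: "Poly_Mapping.keys (mconst c * f) \<subseteq> Poly_Mapping.keys f"
  using keys_mult[of "mconst c" f] by (auto simp: mconst_def split: if_splits)

lemma mvars_single: "mvars (Poly_Mapping.single \<alpha> c) \<subseteq> Poly_Mapping.keys \<alpha>"
  by (auto simp: mvars_def split: if_splits)

lemma mvars_mconst [simp]: "mvars (mconst c) = {}"
  using mvars_single[of 0 c] by (auto simp: mconst_def)

lemma mvars_of_int [simp]: "mvars (of_int k) = {}"
  by (metis mconst_of_int mvars_mconst)

lemma mvars_0 [simp]: "mvars 0 = {}"
  by (simp add: mvars_def)

lemma mvars_1 [simp]: "mvars 1 = {}"
  using mvars_mconst[of 1] by simp

lemma mvars_mvar [simp]: "mvars (mvar i) = {i}"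
  by (simp add: mvars_def mvar_def)

lemma mvars_add: "mvars (p + q) \<subseteq> mvars p \<union> mvars q"
  using Poly_Mapping.keys_add[of p q] by (auto simp: mvars_def)

lemma mvars_diff: "mvars (p - q) \<subseteq> mvars p \<union> mvars q"
proof -
  have "Poly_Mapping.keys (p - q) \<subseteq> Poly_Mapping.keys p \<union> Poly_Mapping.keys q"
    by (auto simp: in_keys_iff lookup_minus)
  then show ?thesis by (auto simp: mvars_def)
qed

lemma mvars_mult: "mvars (p * q) \<subseteq> mvars p \<union> mvars q"
proof
  fix i assume "i \<in> mvars (p * q)"
  then obtain \<gamma> where \<gamma>: "\<gamma> \<in> Poly_Mapping.keys (p * q)" "i \<in> Poly_Mapping.keys \<gamma>"
    by (auto simp: mvars_def)
  then obtain \<alpha> \<beta> where "\<gamma> = \<alpha> + \<beta>" "\<alpha> \<in> Poly_Mapping.keys p" "\<beta> \<in> Poly_Mapping.keys q"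
    using keys_mult[of p q] by blast
  with \<gamma> show "i \<in> mvars p \<union> mvars q"
    using Poly_Mapping.keys_add[of \<alpha> \<beta>] by (auto simp: mvars_def)
qed

lemma mvars_sum: "(\<And>x. x \<in> A \<Longrightarrow> mvars (f x) \<subseteq> V) \<Longrightarrow> mvars (sum f A) \<subseteq> V"
  by (induction A rule: infinite_finite_induct) (auto dest!: mvars_add[THEN subsetD])

lemma mvars_prod: "(\<And>x. x \<in> A \<Longrightarrow> mvars (f x) \<subseteq> V) \<Longrightarrow> mvars (prod f A) \<subseteq> V"
  by (induction A rule: infinite_finite_induct) (auto dest!: mvars_mult[THEN subsetD])

lemma mvars_power: "mvars (p ^ k) \<subseteq> mvars p"
  by (induction k) (auto dest!: mvars_mult[THEN subsetD])

lemma mvars_empty_imp_mconst: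
  assumes "mvars p = {}"
  obtains c where "p = mconst c"
proof
  have "\<alpha> = 0" if "\<alpha> \<in> Poly_Mapping.keys p" for \<alpha>
    using assms that by (auto simp: mvars_def)
  then have "Poly_Mapping.lookup p \<alpha> = 0" if "\<alpha> \<noteq> 0" for \<alpha>
    using that by (auto simp: in_keys_iff)
  then show "p = mconst (Poly_Mapping.lookup p 0)"
    by (intro poly_mapping_eqI) (auto simp: mconst_def lookup_single when_def)
qed

lemma rename_vars_single:
  "rename_vars \<sigma> (Poly_Mapping.single \<alpha> c) =
     mconst c * (\<Prod>i\<in>Poly_Mapping.keys \<alpha>. mvar (\<sigma> i) ^ Poly_Mapping.lookup \<alpha> i)"
  by (simp add: rename_vars_def)

lemma rename_vars_add: "rename_vars \<sigma> (p + q) = rename_vars \<sigma> p + rename_vars \<sigma> q"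
  unfolding rename_vars_def
  by (rule setsum_keys_plus_distrib) (simp_all add: mconst_add distrib_right)

lemma rename_vars_0 [simp]: "rename_vars \<sigma> 0 = 0"
  by (simp add: rename_vars_def)

lemma rename_vars_sum: "rename_vars \<sigma> (sum f A) = (\<Sum>x\<in>A. rename_vars \<sigma> (f x))"
  by (induction A rule: infinite_finite_induct) (simp_all add: rename_vars_add)

lemma rename_vars_diff: "rename_vars \<sigma> (p - q) = rename_vars \<sigma> p - rename_vars \<sigma> q"
  using rename_vars_add[of \<sigma> "p - q" q] by (simp add: algebra_simps)

lemma rename_vars_mult: "rename_vars \<sigma> (p * q) = rename_vars \<sigma> p * rename_vars \<sigma> q"
proof -
  have ext: "(\<Prod>i\<in>Poly_Mapping.keys \<gamma>. mvar (\<sigma> i) ^ Poly_Mapping.lookup \<gamma> i) =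
      (\<Prod>i\<in>A. mvar (\<sigma> i) ^ Poly_Mapping.lookup \<gamma> i)"
    if "finite A" "Poly_Mapping.keys \<gamma> \<subseteq> A" for \<gamma> :: "nat \<Rightarrow>\<^sub>0 nat" and A
    using that by (intro prod.mono_neutral_left) (auto simp: in_keys_iff)
  have single: "rename_vars \<sigma> (Poly_Mapping.single \<alpha> c * Poly_Mapping.single \<beta> d) =
      rename_vars \<sigma> (Poly_Mapping.single \<alpha> c) * rename_vars \<sigma> (Poly_Mapping.single \<beta> d)" for \<alpha> \<beta> c d
  proof -
    let ?A = "Poly_Mapping.keys \<alpha> \<union> Poly_Mapping.keys \<beta>"
    have "rename_vars \<sigma> (Poly_Mapping.single (\<alpha> + \<beta>) (c * d)) =
      mconst (c * d) * (\<Prod>i\<in>?A. mvar (\<sigma> i) ^ Poly_Mapping.lookup (\<alpha> + \<beta>) i)"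
      using Poly_Mapping.keys_add[of \<alpha> \<beta>] by (simp add: rename_vars_single ext[of ?A])
    also have "\<dots> = (mconst c * (\<Prod>i\<in>?A. mvar (\<sigma> i) ^ Poly_Mapping.lookup \<alpha> i)) *
        (mconst d * (\<Prod>i\<in>?A. mvar (\<sigma> i) ^ Poly_Mapping.lookup \<beta> i))"
      by (simp add: mconst_mult lookup_add power_add prod.distrib mult_ac)
    finally show ?thesis by (simp add: mult_single rename_vars_single ext[of ?A])
  qed
  show ?thesis
    apply (subst (1 2) cmpoly_as_sum[of p, symmetric])
    apply (subst (1 2) cmpoly_as_sum[of q, symmetric])
    apply (simp add: sum_product rename_vars_sum single)
    done
qed

lemma rename_vars_mconst [simp]: "rename_vars \<sigma> (mconst c) = mconst c"
  unfolding mconst_def by (simp add: rename_vars_single mconst_def)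

lemma rename_vars_of_int [simp]: "rename_vars \<sigma> (of_int k) = of_int k"
  by (metis mconst_of_int rename_vars_mconst)

lemma rename_vars_1 [simp]: "rename_vars \<sigma> 1 = 1"
  by (metis mconst_1 rename_vars_mconst)

lemma rename_vars_mvar [simp]: "rename_vars \<sigma> (mvar i) = mvar (\<sigma> i)"
  by (simp add: mvar_def rename_vars_single)

lemma rename_vars_prod: "rename_vars \<sigma> (prod f A) = (\<Prod>x\<in>A. rename_vars \<sigma> (f x))"
  by (induction A rule: infinite_finite_induct) (simp_all add: rename_vars_mult)

lemma rename_vars_power: "rename_vars \<sigma> (p ^ k) = rename_vars \<sigma> p ^ k"
  by (induction k) (simp_all add: rename_vars_mult)

lemma mvars_rename_vars: "mvars (rename_vars \<sigma> p) \<subseteq> \<sigma> ` mvars p"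
  unfolding rename_vars_def
proof (rule mvars_sum)
  fix \<alpha> assume \<alpha>: "\<alpha> \<in> Poly_Mapping.keys p"
  have "mvars (\<Prod>i\<in>Poly_Mapping.keys \<alpha>. mvar (\<sigma> i) ^ Poly_Mapping.lookup \<alpha> i) \<subseteq> \<sigma> ` mvars p"
    using \<alpha> by (intro mvars_prod order.trans[OF mvars_power]) (auto simp: mvars_def[of p])
  then show "mvars (mconst (Poly_Mapping.lookup p \<alpha>) *
      (\<Prod>i\<in>Poly_Mapping.keys \<alpha>. mvar (\<sigma> i) ^ Poly_Mapping.lookup \<alpha> i)) \<subseteq> \<sigma> ` mvars p"
    using mvars_mult by fastforce
qed

lemma mvars_in_y: "mvars f \<subseteq> {..<m} \<Longrightarrow> mvars (in_y m f) \<subseteq> {m..<2 * m}"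
  unfolding in_y_def by (rule order.trans[OF mvars_rename_vars]) auto

lemma in_y_mult: "in_y m (p * q) = in_y m p * in_y m q"
  and in_y_sum: "in_y m (sum f A) = (\<Sum>x\<in>A. in_y m (f x))"
  and in_y_mconst [simp]: "in_y m (mconst c) = mconst c"
  by (simp_all add: in_y_def rename_vars_mult rename_vars_sum)

section \<open>Applying the functional in some of the variables\<close>

lemma int_var_single:
  "int_var L i (Poly_Mapping.single \<alpha> c) =
     Poly_Mapping.single (Poly_Mapping.update i 0 \<alpha>) (c * L (monom 1 (Poly_Mapping.lookup \<alpha> i)))"
  by (simp add: int_var_def)

lemma int_var_add: "int_var L i (p + q) = int_var L i p + int_var L i q"
  unfolding int_var_def
  by (rule setsum_keys_plus_distrib) (simp_all add: distrib_right single_add)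

lemma int_var_0 [simp]: "int_var L i 0 = 0"
  by (simp add: int_var_def)

lemma int_var_sum: "int_var L i (sum f A) = (\<Sum>x\<in>A. int_var L i (f x))"
  by (induction A rule: infinite_finite_induct) (simp_all add: int_var_add)

lemma mvars_int_var: "mvars (int_var L i p) \<subseteq> mvars p - {i}"
  unfolding int_var_def
proof (rule mvars_sum)
  fix \<alpha> assume "\<alpha> \<in> Poly_Mapping.keys p"
  then have "Poly_Mapping.keys (Poly_Mapping.update i 0 \<alpha>) \<subseteq> mvars p - {i}"
    by (auto simp: keys_update mvars_def)
  then show "mvars (Poly_Mapping.single (Poly_Mapping.update i 0 \<alpha>)
      (Poly_Mapping.lookup p \<alpha> * L (monom 1 (Poly_Mapping.lookup \<alpha> i)))) \<subseteq> mvars p - {i}"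
    using mvars_single by blast
qed

text \<open>
  A factor free of \<open>x\<^sub>i\<close> can be pulled out of the functional in \<open>x\<^sub>i\<close>, because it does not change
  the exponent of \<open>x\<^sub>i\<close> in any monomial.
\<close>

lemma int_var_mult_left:
  assumes "i \<notin> mvars q"
  shows "int_var L i (q * p) = q * int_var L i p"
proof -
  have single: "int_var L i (Poly_Mapping.single \<beta> c * Poly_Mapping.single \<alpha> d) =
      Poly_Mapping.single \<beta> c * int_var L i (Poly_Mapping.single \<alpha> d)"
    if "\<beta> \<in> Poly_Mapping.keys q" for \<alpha> \<beta> c d
  proof -
    have \<beta>: "Poly_Mapping.lookup \<beta> i = 0"
      using assms that by (auto simp: mvars_def in_keys_iff)
    then have "Poly_Mapping.update i 0 (\<beta> + \<alpha>) = \<beta> + Poly_Mapping.update i 0 \<alpha>"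
      by (intro poly_mapping_eqI) (auto simp: lookup_update lookup_add)
    with \<beta> show ?thesis
      by (simp add: mult_single int_var_single lookup_add mult.assoc)
  qed
  show ?thesis
    apply (subst (1 2) cmpoly_as_sum[of q, symmetric])
    apply (subst (1 2) cmpoly_as_sum[of p, symmetric])
    apply (simp add: sum_product int_var_sum single)
    done
qed

text \<open>
  Multivariate polynomials are built below as products of univariate ones in separate variables,
  as on such a product the functional acts factor by factor.
\<close>

definition in_var :: "nat \<Rightarrow> complex poly \<Rightarrow> cmpoly" where
  "in_var i q = poly (map_poly mconst q) (mvar i)"

lemma in_var_0 [simp]: "in_var i 0 = 0"
  by (simp add: in_var_def)

lemma in_var_pCons: "in_var i (pCons a q) = mconst a + mvar i * in_var i q"
  by (simp add: in_var_def map_poly_pCons)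

lemma in_var_add: "in_var i (p + q) = in_var i p + in_var i q"
  by (induction p q rule: poly_induct2) (simp_all add: in_var_pCons mconst_add algebra_simps)

lemma in_var_smult: "in_var i (smult c p) = mconst c * in_var i p"
  by (induction p) (simp_all add: in_var_pCons mconst_mult algebra_simps)

lemma in_var_mult: "in_var i (p * q) = in_var i p * in_var i q"
  by (induction p) (simp_all add: in_var_pCons in_var_add in_var_smult algebra_simps)

lemma in_var_sum: "in_var i (sum f A) = (\<Sum>x\<in>A. in_var i (f x))"
  by (induction A rule: infinite_finite_induct) (simp_all add: in_var_add)

lemma in_var_monom: "in_var i (monom c k) = mconst c * mvar i ^ k"
  by (induction k) (simp_all add: monom_0 monom_Suc in_var_pCons mult_ac)

lemma mvars_in_var: "mvars (in_var i p) \<subseteq> {i}"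
proof (induction p)
  case (pCons a p)
  then show ?case using mvars_add mvars_mult by (fastforce simp: in_var_pCons)
qed simp

lemma rename_vars_in_var [simp]: "rename_vars \<sigma> (in_var i p) = in_var (\<sigma> i) p"
  by (induction p) (simp_all add: in_var_pCons rename_vars_add rename_vars_mult)

lemma in_var_as_sum: "in_var i p = (\<Sum>k\<le>degree p. mconst (poly.coeff p k) * mvar i ^ k)"
  by (subst poly_as_sum_of_monoms[symmetric]) (simp add: in_var_sum in_var_monom)

lemma keys_in_var: "Poly_Mapping.keys (in_var i p) \<subseteq> Poly_Mapping.single i ` {..degree p}"
proof -
  have "Poly_Mapping.keys (in_var i p) \<subseteq>
      (\<Union>k\<le>degree p. Poly_Mapping.keys (mconst (poly.coeff p k) * mvar i ^ k))"
    unfolding in_var_as_sum by (rule Poly_Mapping.keys_sum)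
  also have "\<dots> \<subseteq> Poly_Mapping.single i ` {..degree p}"
    by (auto simp: mvar_power mconst_mult_single split: if_splits)
  finally show ?thesis .
qed

text \<open>
  Bounds the degree in each variable; this is how the degree condition of \<open>antisym_space\<close> is
  verified.
\<close>

lemma keys_prod_in_var:
  assumes "finite A" "\<alpha> \<in> Poly_Mapping.keys (\<Prod>b\<in>A. in_var b (q b))" "i \<in> A"
  shows "Poly_Mapping.lookup \<alpha> i \<le> degree (q i)"
proof -
  have "(\<forall>b\<in>A. Poly_Mapping.lookup \<alpha> b \<le> degree (q b)) \<and> (\<forall>b. b \<notin> A \<longrightarrow> Poly_Mapping.lookup \<alpha> b = 0)"
    using assms(1,2)
  proof (induction A arbitrary: \<alpha> rule: finite_induct)
    case (insert a A)
    then obtain \<beta> \<gamma> where \<alpha>: "\<alpha> = \<beta> + \<gamma>" and \<beta>: "\<beta> \<in> Poly_Mapping.keys (in_var a (q a))"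
      and \<gamma>: "\<gamma> \<in> Poly_Mapping.keys (\<Prod>b\<in>A. in_var b (q b))"
      using keys_mult[of "in_var a (q a)"] by fastforce
    from \<beta> obtain k where "\<beta> = Poly_Mapping.single a k" "k \<le> degree (q a)"
      using keys_in_var by blast
    with insert.IH[OF \<gamma>] insert.hyps \<alpha> show ?case
      by (auto simp: lookup_add lookup_single when_def)
  qed (simp add: lookup_one)
  with assms(3) show ?thesis by blast
qed

lemma int_var_mconst_mult: "int_var L i (mconst c * p) = mconst c * int_var L i p"
  by (simp add: int_var_mult_left)

lemma mvars_fold_int_var: "mvars (fold (int_var L) xs p) \<subseteq> mvars p - set xs"
proof (induction xs arbitrary: p)
  case (Cons x xs)
  then show ?case using mvars_int_var[of L x p] by fastforce
qed simp

lemma fold_int_var_sum: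
  "fold (int_var L) xs (sum f A) = (\<Sum>a\<in>A. fold (int_var L) xs (f a))"
  by (induction xs arbitrary: f) (simp_all add: int_var_sum)

lemma fold_int_var_mult_left:
  "mvars q \<inter> set xs = {} \<Longrightarrow> fold (int_var L) xs (q * p) = q * fold (int_var L) xs p"
  by (induction xs arbitrary: p) (simp_all add: int_var_mult_left)

context
  fixes L :: "complex poly \<Rightarrow> complex"
  assumes lin: "Vector_Spaces.linear smult (*) L"
begin

lemma functional_add: "L (p + q) = L p + L q"
  and functional_smult: "L (smult c p) = c * L p"
  using lin unfolding Vector_Spaces.linear_iff by auto

lemma functional_0: "L 0 = 0"
  using functional_smult[of 0 0] by simp

lemma functional_sum: "L (sum f A) = (\<Sum>a\<in>A. L (f a))"
  by (induction A rule: infinite_finite_induct) (simp_all add: functional_add functional_0)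

lemma int_var_in_var: "int_var L i (in_var i p) = mconst (L p)"
proof -
  have "int_var L i (mvar i ^ k) = mconst (L (monom 1 k))" for k
  proof -
    have "Poly_Mapping.update i 0 (Poly_Mapping.single i k) = 0"
      by (rule poly_mapping_eqI) (auto simp: lookup_update lookup_single when_def)
    then show ?thesis by (simp add: mvar_power int_var_single mconst_def)
  qed
  then have "int_var L i (in_var i p) = mconst (\<Sum>k\<le>degree p. poly.coeff p k * L (monom 1 k))"
    by (simp add: in_var_as_sum int_var_sum int_var_mconst_mult mconst_sum mconst_mult)
  also have "(\<Sum>k\<le>degree p. poly.coeff p k * L (monom 1 k)) = L (\<Sum>k\<le>degree p. monom (poly.coeff p k) k)"
    by (simp add: functional_sum smult_monom flip: functional_smult)
  finally show ?thesis by (simp add: poly_as_sum_of_monoms)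
qed

lemma fold_int_var_prod_in_var:
  assumes "distinct xs" "mvars q \<inter> set xs = {}"
  shows "fold (int_var L) xs (q * (\<Prod>b\<in>set xs. in_var b (r b))) = q * mconst (\<Prod>b\<in>set xs. L (r b))"
  using assms
proof (induction xs arbitrary: q)
  case (Cons x xs)
  have "x \<notin> mvars (\<Prod>b\<in>set xs. in_var b (r b))"
    using mvars_prod[of "set xs" "\<lambda>b. in_var b (r b)" "set xs"] mvars_in_var Cons.prems by fastforce
  then have nx: "x \<notin> mvars (q * (\<Prod>b\<in>set xs. in_var b (r b)))"
    using mvars_mult[of q] Cons.prems by fastforce
  have "int_var L x (q * (\<Prod>b\<in>set (x # xs). in_var b (r b))) =
      int_var L x ((q * (\<Prod>b\<in>set xs. in_var b (r b))) * in_var x (r x))"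
    using Cons.prems by (simp add: mult_ac)
  also have "\<dots> = (q * mconst (L (r x))) * (\<Prod>b\<in>set xs. in_var b (r b))"
    by (simp only: int_var_mult_left[OF nx] int_var_in_var) (simp add: mult_ac)
  finally have "fold (int_var L) (x # xs) (q * (\<Prod>b\<in>set (x # xs). in_var b (r b))) =
      fold (int_var L) xs ((q * mconst (L (r x))) * (\<Prod>b\<in>set xs. in_var b (r b)))"
    by simp
  also have "\<dots> = (q * mconst (L (r x))) * mconst (\<Prod>b\<in>set xs. L (r b))"
    using mvars_mult[of q "mconst (L (r x))"] Cons.prems by (intro Cons.IH) auto
  finally show ?case using Cons.prems by (simp add: mconst_mult mult_ac)
qed simp

end

text \<open>
  A renaming that fixes the integration variable commutes with the integration. Injectivity
  guarantees that no other variable is renamed into the integration variable.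
\<close>

lemma rename_vars_int_var:
  assumes "inj \<sigma>" "\<sigma> i = i"
  shows "rename_vars \<sigma> (int_var L i p) = int_var L i (rename_vars \<sigma> p)"
proof -
  have "rename_vars \<sigma> (int_var L i (Poly_Mapping.single \<alpha> c)) =
      int_var L i (rename_vars \<sigma> (Poly_Mapping.single \<alpha> c))" for \<alpha> c
  proof -
    define k where "k = Poly_Mapping.lookup \<alpha> i"
    define q where "q = Poly_Mapping.single (Poly_Mapping.update i 0 \<alpha>) c"
    have "Poly_Mapping.update i 0 \<alpha> + Poly_Mapping.single i k = \<alpha>"
      by (rule poly_mapping_eqI) (auto simp: lookup_update lookup_add lookup_single when_def k_def)
    then have s: "Poly_Mapping.single \<alpha> c = q * mvar i ^ k"
      by (simp add: q_def mvar_power mult_single)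
    have iq: "i \<notin> mvars q"
      using mvars_single[of "Poly_Mapping.update i 0 \<alpha>" c] by (auto simp: q_def keys_update)
    then have "i \<notin> \<sigma> ` mvars q"
      using assms by (metis imageE injD)
    then have irq: "i \<notin> mvars (rename_vars \<sigma> q)"
      using mvars_rename_vars by blast
    \<comment> \<open>The integral of a pure power of the integration variable is a constant, so renaming fixes it.\<close>
    have c: "mvars (int_var L i (mvar i ^ k)) = {}"
      using mvars_int_var[of L i "mvar i ^ k"] mvars_power[of "mvar i" k] by auto
    then obtain d where "int_var L i (mvar i ^ k) = mconst d"
      using mvars_empty_imp_mconst by blast
    then show ?thesis
      using iq irq assms(2)
      by (simp add: s rename_vars_mult rename_vars_power int_var_mult_left)
  qed
  then show ?thesis
    apply (subst (1 2) cmpoly_as_sum[of p, symmetric])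
    apply (simp add: rename_vars_sum int_var_sum)
    done
qed

lemma rename_vars_fold_int_var:
  assumes "inj \<sigma>" "\<And>i. i \<in> set xs \<Longrightarrow> \<sigma> i = i"
  shows "rename_vars \<sigma> (fold (int_var L) xs p) = fold (int_var L) xs (rename_vars \<sigma> p)"
  using assms by (induction xs arbitrary: p) (simp_all add: rename_vars_int_var)

section \<open>The Vandermonde product as a determinant\<close>

text \<open>
  Two families of monic polynomials of degrees \<open>0, 1, 2, ...\<close> differ by a unitriangular change of
  basis, so the determinant of their values at \<open>a 0, ..., a (n - 1)\<close> does not depend on the family.
  For the Newton polynomials \<open>\<Prod>i<k. (X - a i)\<close> the matrix of values is triangular and its
  determinant is the Vandermonde product.
\<close>

lemma vandermonde_product_eq_det:
  fixes a :: "nat \<Rightarrow> 'a :: comm_ring_1" and P :: "nat \<Rightarrow> 'a poly"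
  assumes deg: "\<And>k. degree (P k) \<le> k" and monic: "\<And>k. poly.coeff (P k) k = 1"
  shows "(\<Prod>j<n. \<Prod>i<j. a j - a i) =
    (\<Sum>\<sigma> | \<sigma> permutes {..<n}. of_int (sign \<sigma>) * (\<Prod>b<n. poly (P (\<sigma> b)) (a b)))"
proof -
  define E where "E P = Matrix.mat n n (\<lambda>(b, k). poly (P k) (a b))" for P :: "nat \<Rightarrow> 'a poly"
  define V where "V = Matrix.mat n n (\<lambda>(b, j). a b ^ j)"
  have E: "E P \<in> carrier_mat n n" for P by (simp add: E_def)
  have V: "V \<in> carrier_mat n n" by (simp add: V_def)
  have det_E: "det (E P) = det V"
    if deg: "\<And>k. degree (P k) \<le> k" and monic: "\<And>k. poly.coeff (P k) k = 1" for P
  proof -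
    \<comment> \<open>The coefficients express the given family in the basis of powers, whose values form V.\<close>
    define C where "C = Matrix.mat n n (\<lambda>(j, k). poly.coeff (P k) j)"
    have C: "C \<in> carrier_mat n n" by (simp add: C_def)
    have "upper_triangular C"
      using deg by (auto simp: C_def intro!: upper_triangularI coeff_eq_0 le_less_trans[OF deg])
    then have "det C = prod_list (diag_mat C)" using C by (rule det_upper_triangular)
    also have "\<dots> = (\<Prod>k<n. 1)"
      by (auto simp: prod_list_diag_prod C_def monic lessThan_atLeast0 intro!: prod.cong)
    finally have "det C = 1" by simp
    moreover have "E P = V * C"
    proof (rule eq_matI)
      fix b k assume "b < dim_row (V * C)" "k < dim_col (V * C)"
      then have bk: "b < n" "k < n" by (auto simp: V_def C_def)
      have "poly (P k) (a b) = (\<Sum>j\<le>degree (P k). poly.coeff (P k) j * a b ^ j)"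
        by (rule poly_altdef)
      also have "\<dots> = (\<Sum>j<n. poly.coeff (P k) j * a b ^ j)"
        using deg[of k] bk by (intro sum.mono_neutral_left) (auto simp: coeff_eq_0)
      finally show "E P $$ (b, k) = (V * C) $$ (b, k)"
        using bk by (simp add: E_def V_def C_def scalar_prod_def lessThan_atLeast0 mult_ac)
    qed (auto simp: E_def V_def C_def)
    ultimately show ?thesis by (simp add: det_mult[OF V C])
  qed
  define N where "N k = (\<Prod>i<k. [:- a i, 1:])" for k
  have N: "degree (N k) \<le> k \<and> poly.coeff (N k) k = 1" for k
  proof (induction k)
    case (Suc k)
    have N_Suc: "N (Suc k) = smult (- a k) (N k) + pCons 0 (N k)"
      by (simp add: N_def mult.commute)
    have "poly.coeff (N (Suc k)) (Suc k) = 1"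
      using Suc by (simp add: N_Suc coeff_eq_0)
    moreover have "degree (N (Suc k)) \<le> Suc k"
      unfolding N_Suc using Suc
      by (intro degree_add_le order.trans[OF degree_smult_le] order.trans[OF degree_pCons_le]) auto
    ultimately show ?case by simp
  qed (simp add: N_def)
  have "det (E N) = prod_list (diag_mat (E N))"
  proof (rule det_lower_triangular[OF _ E])
    fix b k assume "b < k" "k < n"
    then have "(\<Prod>i<k. a b - a i) = 0"
      by (intro prod_zero) (auto intro: bexI[of _ b])
    with \<open>b < k\<close> \<open>k < n\<close> show "E N $$ (b, k) = 0"
      by (simp add: E_def N_def poly_prod)
  qed
  also have "\<dots> = (\<Prod>j<n. \<Prod>i<j. a j - a i)"
    by (auto simp: prod_list_diag_prod E_def N_def poly_prod lessThan_atLeast0 intro!: prod.cong)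
  finally have "(\<Prod>j<n. \<Prod>i<j. a j - a i) = det (E P)"
    using det_E[of N] det_E[of P] N deg monic by simp
  also have "\<dots> = (\<Sum>\<sigma> | \<sigma> permutes {..<n}. of_int (sign \<sigma>) * (\<Prod>b<n. poly (P (\<sigma> b)) (a b)))"
    unfolding det_def'[OF E]
  proof (intro sum.cong)
    fix \<sigma> assume "\<sigma> \<in> {\<sigma>. \<sigma> permutes {..<n}}"
    then have "\<sigma> b < n" if "b < n" for b using that by (simp add: permutes_nat_less lessThan_atLeast0)
    then show "signof \<sigma> * (\<Prod>i = 0..<n. E P $$ (i, \<sigma> i)) =
        of_int (sign \<sigma>) * (\<Prod>b<n. poly (P (\<sigma> b)) (a b))"
      by (auto simp: E_def lessThan_atLeast0 intro!: prod.cong)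
  qed (simp add: lessThan_atLeast0)
  finally show ?thesis .
qed

definition renamed_vandermonde :: "nat \<Rightarrow> (nat \<Rightarrow> nat) \<Rightarrow> cmpoly" where
  "renamed_vandermonde n u = (\<Prod>j<n. \<Prod>i<j. mvar (u j) - mvar (u i))"

section \<open>Orthogonal polynomials\<close>

lemma monic_family_spans:
  fixes p :: "nat \<Rightarrow> complex poly"
  assumes "\<And>k. k < n \<Longrightarrow> degree (p k) \<le> k" "\<And>k. k < n \<Longrightarrow> poly.coeff (p k) k = 1"
    and "\<forall>k\<ge>n. poly.coeff q k = 0"
  shows "\<exists>d. q = (\<Sum>k<n. smult (d k) (p k))"
  using assms
proof (induction n arbitrary: q)
  case 0
  then show ?case by (auto simp: poly_eq_iff)
next
  case (Suc n)
  define r where "r = q - smult (poly.coeff q n) (p n)"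
  have "poly.coeff r k = 0" if "k \<ge> n" for k
  proof (cases "k = n")
    case True
    then show ?thesis using Suc.prems(2)[of n] by (simp add: r_def)
  next
    case False
    then have "poly.coeff (p n) k = 0"
      using that Suc.prems(1)[of n] by (intro coeff_eq_0) auto
    then show ?thesis using Suc.prems(3) that False by (simp add: r_def)
  qed
  then obtain d where "r = (\<Sum>k<n. smult (d k) (p k))"
    using Suc.IH[of r] Suc.prems by auto
  then have "q = (\<Sum>k<Suc n. smult ((d(n := poly.coeff q n)) k) (p k))"
    by (simp add: r_def algebra_simps)
  then show ?case by blast
qed

text \<open>
  Gram-Schmidt without square roots; the divisors are nonzero when the pairing is nondegenerate
  on the polynomials of each bounded degree.
\<close>

fun orth_poly :: "(complex poly \<Rightarrow> complex) \<Rightarrow> nat \<Rightarrow> complex poly" where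
  "orth_poly L k = monom 1 k -
     (\<Sum>j<k. smult (L (monom 1 k * orth_poly L j) / L (orth_poly L j * orth_poly L j)) (orth_poly L j))"

declare orth_poly.simps [simp del]

text \<open>
  Together with \<open>monic\<close>, the inequality \<open>deg\<close> says that \<open>p k\<close> has degree exactly \<open>k\<close>.
\<close>

locale orthogonal_system =
  fixes L :: "complex poly \<Rightarrow> complex" and p :: "nat \<Rightarrow> complex poly"
  assumes lin: "Vector_Spaces.linear smult (*) L"
    and deg: "degree (p k) \<le> k"
    and monic: "poly.coeff (p k) k = 1"
    and orth: "j \<noteq> k \<Longrightarrow> L (p j * p k) = 0"
    and norm_nz: "L (p k * p k) \<noteq> 0"

text \<open>
  If \<open>L (p\<^sub>k p\<^sub>k)\<close> vanished, then \<open>p\<^sub>k\<close> would be orthogonal to all polynomials of degree at most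
  \<open>k\<close>, as these are spanned by \<open>p\<^sub>0, ..., p\<^sub>k\<close>; nondegeneracy would force the monic
  polynomial \<open>p\<^sub>k\<close> to be zero.
\<close>

lemma orthogonal_system_orth_poly:
  assumes lin: "Vector_Spaces.linear smult (*) L" and nd: "nondegenerate_pairing L"
  shows "orthogonal_system L (orth_poly L)"
proof -
  define p where "p = orth_poly L"
  have p: "p k = monom 1 k - (\<Sum>j<k. smult (L (monom 1 k * p j) / L (p j * p j)) (p j))" for k
    unfolding p_def by (subst orth_poly.simps) simp
  note L = functional_add[OF lin] functional_smult[OF lin] functional_0[OF lin] functional_sum[OF lin]
  have L_diff: "L (f - g) = L f - L g" for f g
    using L(1)[of "f - g" g] by simp
  have main: "degree (p k) \<le> k \<and> poly.coeff (p k) k = 1 \<and>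
      (\<forall>j<k. L (p j * p k) = 0) \<and> L (p k * p k) \<noteq> 0" for k
  proof (induction k rule: less_induct)
    case less_k: (less k)
    let ?c = "\<lambda>j. L (monom 1 k * p j) / L (p j * p j)"
    have deg: "degree (p k) \<le> k"
    proof -
      have "degree (p j) \<le> k" if "j < k" for j
        using less_k.IH[OF that] that by linarith
      then show ?thesis
        by (subst p[of k]) (intro degree_diff_le degree_monom_le degree_sum_le
            order.trans[OF degree_smult_le], simp_all)
    qed
    have monic: "poly.coeff (p k) k = 1"
    proof -
      have "poly.coeff (p j) k = 0" if "j < k" for j
        using less_k.IH[OF that] that by (intro coeff_eq_0) linarith
      then have "(\<Sum>j<k. poly.coeff (smult (?c j) (p j)) k) = 0"
        by (intro sum.neutral) simp
      then show ?thesis by (subst p[of k]) (simp only: coeff_diff coeff_sum coeff_monom, simp)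
    qed
    have orth: "L (p j * p k) = 0" if "j < k" for j
    proof -
      have "L (p j * p i) = 0" if "i < k" "i \<noteq> j" for i
      proof (cases "i < j")
        case True
        then have "L (p i * p j) = 0" using less_k.IH[of j] \<open>j < k\<close> by blast
        then show ?thesis by (simp only: mult.commute[of "p j" "p i"])
      next
        case False
        then show ?thesis using less_k.IH[of i] that by simp
      qed
      then have "L (p j * (\<Sum>i<k. smult (?c i) (p i))) =
          (\<Sum>i<k. if i = j then ?c i * L (p j * p j) else 0)"
        unfolding sum_distrib_left mult_smult_right L by (intro sum.cong refl) auto
      also have "\<dots> = L (p j * monom 1 k)"
        using less_k.IH[of j] that by (simp add: mult.commute[of "p j" "monom 1 k"])
      finally show ?thesis by (subst p[of k]) (simp add: right_diff_distrib L_diff)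
    qed
    have "L (p k * p k) \<noteq> 0"
    proof
      assume zero: "L (p k * p k) = 0"
      have "L (p k * g) = 0" if "degree g \<le> k" for g
      proof -
        have "\<exists>d. g = (\<Sum>j<Suc k. smult (d j) (p j))"
        proof (rule monic_family_spans)
          show "degree (p i) \<le> i" "poly.coeff (p i) i = 1" if "i < Suc k" for i
            using less_k.IH[of i] deg monic that by (cases "i = k"; simp)+
          show "\<forall>i\<ge>Suc k. poly.coeff g i = 0"
            using that by (intro allI impI coeff_eq_0) simp
        qed
        then obtain d where g: "g = (\<Sum>j<Suc k. smult (d j) (p j))" ..
        have "L (p k * g) = L (g * p k)" by (simp only: mult.commute)
        also have "\<dots> = (\<Sum>j<Suc k. d j * L (p j * p k))"
          by (simp only: g sum_distrib_right L mult_smult_left)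
        also have "\<dots> = 0" using zero orth by simp
        finally show ?thesis .
      qed
      then have "p k = 0"
        using nd[unfolded nondegenerate_pairing_def, rule_format, of "Suc k" "p k"] deg by simp
      with monic show False by simp
    qed
    with deg monic orth show ?case by blast
  qed
  have "L (p j * p k) = 0" if "j \<noteq> k" for j k
  proof (cases "j < k")
    case True
    then show ?thesis using main[of k] by blast
  next
    case False
    then have "L (p k * p j) = 0" using main[of j] that by simp
    then show ?thesis by (simp only: mult.commute[of "p j" "p k"])
  qed
  with lin main show ?thesis
    unfolding p_def[symmetric] by (intro orthogonal_system.intro) simp_all
qed

section \<open>Permutations with prescribed values\<close>

text \<open>
  Choose one permutation \<open>\<tau>\<close> that extends \<open>s\<close>; the extensions of \<open>s\<close> are the products \<open>\<tau> \<circ> \<rho>\<close> with a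
  permutation \<open>\<rho>\<close> of the \<open>n - m\<close> points outside \<open>{..<m}\<close>.
\<close>

lemma card_permutations_extending:
  assumes inj: "inj_on s {..<m}" and range: "\<And>b. b < m \<Longrightarrow> s b < n"
  shows "card {\<tau>. \<tau> permutes {..<n} \<and> (\<forall>b<m. \<tau> b = s b)} = fact (n - m)"
proof -
  have sub: "s ` {..<m} \<subseteq> {..<n}" using range by auto
  have mn: "m \<le> n" using card_mono[OF _ sub] by (simp add: card_image[OF inj])
  have "card {m..<n} = card ({..<n} - s ` {..<m})"
    using sub by (simp add: card_Diff_subset finite_subset card_image[OF inj])
  then obtain g where g: "bij_betw g {m..<n} ({..<n} - s ` {..<m})"
    using finite_same_card_bij by (metis finite_Diff finite_atLeastLessThan finite_lessThan)
  define \<tau> where "\<tau> b = (if b < m then s b else if b < n then g b else b)" for b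
  have "bij_betw \<tau> {..<m} (s ` {..<m})"
    using inj by (subst bij_betw_cong[of _ _ s]) (auto simp: \<tau>_def bij_betw_def)
  moreover have "bij_betw \<tau> {m..<n} ({..<n} - s ` {..<m})"
    using g by (subst bij_betw_cong[of _ _ g]) (auto simp: \<tau>_def)
  ultimately have "bij_betw \<tau> ({..<m} \<union> {m..<n}) (s ` {..<m} \<union> ({..<n} - s ` {..<m}))"
    by (rule bij_betw_combine) auto
  moreover have "{..<m} \<union> {m..<n} = {..<n}" "s ` {..<m} \<union> ({..<n} - s ` {..<m}) = {..<n}"
    using mn sub by auto
  ultimately have "bij_betw \<tau> {..<n} {..<n}" by simp
  then have \<tau>: "\<tau> permutes {..<n}"
    by (rule bij_imp_permutes) (use mn in \<open>auto simp: \<tau>_def\<close>)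
  have "bij_betw (\<lambda>\<rho>. \<tau> \<circ> \<rho>) {\<rho>. \<rho> permutes {m..<n}}
      {\<tau>. \<tau> permutes {..<n} \<and> (\<forall>b<m. \<tau> b = s b)}"
  proof (rule bij_betw_byWitness[where f' = "\<lambda>\<sigma>. Hilbert_Choice.inv \<tau> \<circ> \<sigma>"])
    show "\<forall>\<rho>\<in>{\<rho>. \<rho> permutes {m..<n}}. Hilbert_Choice.inv \<tau> \<circ> (\<tau> \<circ> \<rho>) = \<rho>"
      using permutes_inv_o(2)[OF \<tau>] by (simp add: o_assoc)
    show "\<forall>\<sigma>\<in>{\<tau>. \<tau> permutes {..<n} \<and> (\<forall>b<m. \<tau> b = s b)}. \<tau> \<circ> (Hilbert_Choice.inv \<tau> \<circ> \<sigma>) = \<sigma>"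
      using permutes_inv_o(1)[OF \<tau>] by (simp add: o_assoc)
    show "(\<lambda>\<rho>. \<tau> \<circ> \<rho>) ` {\<rho>. \<rho> permutes {m..<n}} \<subseteq> {\<tau>. \<tau> permutes {..<n} \<and> (\<forall>b<m. \<tau> b = s b)}"
    proof safe
      fix \<rho> assume \<rho>: "\<rho> permutes {m..<n}"
      then have "\<rho> permutes {..<n}" by (rule permutes_subset) auto
      then show "\<tau> \<circ> \<rho> permutes {..<n}" using \<tau> by (rule permutes_compose)
      show "(\<tau> \<circ> \<rho>) b = s b" if "b < m" for b
        using permutes_not_in[OF \<rho>, of b] that by (simp add: \<tau>_def)
    qed
    show "(\<lambda>\<sigma>. Hilbert_Choice.inv \<tau> \<circ> \<sigma>) ` {\<tau>. \<tau> permutes {..<n} \<and> (\<forall>b<m. \<tau> b = s b)} \<subseteq> {\<rho>. \<rho> permutes {m..<n}}"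
    proof safe
      fix \<sigma> assume \<sigma>: "\<sigma> permutes {..<n}" "\<forall>b<m. \<sigma> b = s b"
      show "Hilbert_Choice.inv \<tau> \<circ> \<sigma> permutes {m..<n}"
      proof (rule permutes_superset)
        show "Hilbert_Choice.inv \<tau> \<circ> \<sigma> permutes {..<n}"
          using \<sigma>(1) permutes_inv[OF \<tau>] by (rule permutes_compose)
        fix b assume "b \<in> {..<n} - {m..<n}"
        then have "b < m" by auto
        then have "\<sigma> b = \<tau> b" using \<sigma>(2) by (simp add: \<tau>_def)
        then show "(Hilbert_Choice.inv \<tau> \<circ> \<sigma>) b = b" using permutes_inverses(2)[OF \<tau>] by simp
      qed
    qed
  qed
  then have "card {\<tau>. \<tau> permutes {..<n} \<and> (\<forall>b<m. \<tau> b = s b)} = card {\<rho>. \<rho> permutes {m..<n}}"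
    by (simp add: bij_betw_same_card)
  then show ?thesis by (simp add: card_permutations)
qed

text \<open>
  The permutations that agree with \<open>\<tau>\<close> off \<open>{..<m}\<close> form the left coset of \<open>\<tau>\<close> for the
  permutations of \<open>{..<m}\<close>. Orthogonality in the integrated variables selects exactly these.
\<close>

lemma sum_permutations_agreeing_outside:
  fixes F :: "(nat \<Rightarrow> nat) \<Rightarrow> 'b :: comm_monoid_add"
  assumes \<tau>: "\<tau> permutes {..<n}" and mn: "m \<le> n"
  shows "(\<Sum>\<sigma> | \<sigma> permutes {..<n} \<and> (\<forall>b\<in>{m..<n}. \<sigma> b = \<tau> b). F \<sigma>) =
    (\<Sum>\<pi> | \<pi> permutes {..<m}. F (\<tau> \<circ> \<pi>))"
proof (rule sum.reindex_bij_witness[where i = "\<lambda>\<pi>. \<tau> \<circ> \<pi>" and j = "\<lambda>\<sigma>. Hilbert_Choice.inv \<tau> \<circ> \<sigma>"])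
  fix \<sigma> assume "\<sigma> \<in> {\<sigma>. \<sigma> permutes {..<n} \<and> (\<forall>b\<in>{m..<n}. \<sigma> b = \<tau> b)}"
  then have \<sigma>: "\<sigma> permutes {..<n}" "\<forall>b\<in>{m..<n}. \<sigma> b = \<tau> b" by auto
  show "\<tau> \<circ> (Hilbert_Choice.inv \<tau> \<circ> \<sigma>) = \<sigma>"
    using permutes_inv_o(1)[OF \<tau>] by (simp add: o_assoc)
  then show "F (\<tau> \<circ> (Hilbert_Choice.inv \<tau> \<circ> \<sigma>)) = F \<sigma>" by simp
  have "Hilbert_Choice.inv \<tau> \<circ> \<sigma> permutes {..<m}"
  proof (rule permutes_superset)
    show "Hilbert_Choice.inv \<tau> \<circ> \<sigma> permutes {..<n}"
      using \<sigma>(1) permutes_inv[OF \<tau>] by (rule permutes_compose)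
    show "(Hilbert_Choice.inv \<tau> \<circ> \<sigma>) b = b" if "b \<in> {..<n} - {..<m}" for b
      using \<sigma>(2) that permutes_inverses(2)[OF \<tau>] by simp
  qed
  then show "Hilbert_Choice.inv \<tau> \<circ> \<sigma> \<in> {\<pi>. \<pi> permutes {..<m}}" by simp
next
  fix \<pi> assume "\<pi> \<in> {\<pi>. \<pi> permutes {..<m}}"
  then have \<pi>: "\<pi> permutes {..<m}" by simp
  show "Hilbert_Choice.inv \<tau> \<circ> (\<tau> \<circ> \<pi>) = \<pi>"
    using permutes_inv_o(2)[OF \<tau>] by (simp add: o_assoc)
  have "\<pi> permutes {..<n}" using \<pi> mn by (auto intro: permutes_subset)
  then have "\<tau> \<circ> \<pi> permutes {..<n}" using \<tau> by (rule permutes_compose)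
  moreover have "\<pi> b = b" if "m \<le> b" for b
    using permutes_not_in[OF \<pi>] that by simp
  ultimately show "\<tau> \<circ> \<pi> \<in> {\<sigma>. \<sigma> permutes {..<n} \<and> (\<forall>b\<in>{m..<n}. \<sigma> b = \<tau> b)}" by simp
qed

section \<open>Antisymmetrization and antisymmetric tensors\<close>

lemma sign_compose_permutes:
  fixes k l :: nat
  assumes "\<sigma> permutes {..<k}" "\<tau> permutes {..<l}"
  shows "sign (\<sigma> \<circ> \<tau>) = sign \<sigma> * sign \<tau>"
  using assms by (intro sign_compose permutes_imp_permutation[OF finite_lessThan])

lemma of_int_sign_square: "of_int (sign \<sigma>) * of_int (sign \<sigma>) = (1 :: 'a :: ring_1)"
  by (metis of_int_1 of_int_mult sign_idempotent)

definition antisymmetrize :: "nat \<Rightarrow> cmpoly \<Rightarrow> cmpoly" where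
  "antisymmetrize m f = (\<Sum>\<pi> | \<pi> permutes {..<m}. of_int (sign \<pi>) * rename_vars \<pi> f)"

lemma antisymmetrize_antisymmetric:
  assumes "antisymmetric_in m f"
  shows "antisymmetrize m f = mconst (fact m) * f"
proof -
  have "antisymmetrize m f = (\<Sum>\<pi> | \<pi> permutes {..<m}. f)"
    unfolding antisymmetrize_def
  proof (rule sum.cong)
    fix \<pi> assume "\<pi> \<in> {\<pi>. \<pi> permutes {..<m}}"
    then have "rename_vars \<pi> f = of_int (sign \<pi>) * f"
      using assms by (simp add: antisymmetric_in_def)
    then show "of_int (sign \<pi>) * rename_vars \<pi> f = f"
      by (simp add: mult.assoc[symmetric] of_int_sign_square)
  qed simp
  also have "\<dots> = of_nat (fact m) * f"
    using card_permutations[of "{..<m}" m] by (simp only: sum_constant card_lessThan finite_lessThan)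
  also have "of_nat (fact m) = mconst (fact m)"
    by (simp only: mconst_of_nat[symmetric] of_nat_fact)
  finally show ?thesis .
qed

lemma antisymmetrize_sum: "antisymmetrize m (sum f A) = (\<Sum>a\<in>A. antisymmetrize m (f a))"
  unfolding antisymmetrize_def rename_vars_sum sum_distrib_left by (rule sum.swap)

lemma antisymmetrize_mconst_mult: "antisymmetrize m (mconst c * f) = mconst c * antisymmetrize m f"
  unfolding antisymmetrize_def rename_vars_mult rename_vars_mconst sum_distrib_left
  by (simp only: mult.left_commute)

lemma antisym_space_mconst_mult:
  assumes "f \<in> antisym_space n m"
  shows "mconst c * f \<in> antisym_space n m"
proof -
  have "mvars (mconst c * f) \<subseteq> mvars f" using mvars_mult[of "mconst c" f] by simp
  moreover have "Poly_Mapping.keys (mconst c * f) \<subseteq> Poly_Mapping.keys f"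
    by (rule keys_mconst_mult)
  moreover have "antisymmetric_in m (mconst c * f)"
    using assms by (auto simp: antisym_space_def antisymmetric_in_def rename_vars_mult mult.left_commute)
  ultimately show ?thesis using assms by (auto simp: antisym_space_def)
qed

lemma antisym_tensorE:
  assumes "R \<in> antisym_tensor n m"
  obtains N :: nat and f g where "R = (\<Sum>k<N. f k * in_y m (g k))"
    and "\<And>k. k < N \<Longrightarrow> f k \<in> antisym_space n m" "\<And>k. k < N \<Longrightarrow> g k \<in> antisym_space n m"
proof -
  let ?P = "\<lambda>(N :: nat) f g. R = (\<Sum>k<N. f k * in_y m (g k)) \<and>
      (\<forall>k<N. f k \<in> antisym_space n m \<and> g k \<in> antisym_space n m)"
  have "\<exists>N f g. ?P N f g"
    using assms by (simp only: antisym_tensor_def mem_Collect_eq)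
  then obtain N where "\<exists>f g. ?P N f g" ..
  then obtain f where "\<exists>g. ?P N f g" ..
  then obtain g where "?P N f g" ..
  then show thesis by (intro that[where N = N and f = f and g = g]) simp_all
qed

lemma antisym_tensor_finite_sum:
  assumes "finite A" "\<And>a. a \<in> A \<Longrightarrow> f a \<in> antisym_space n m" "\<And>a. a \<in> A \<Longrightarrow> g a \<in> antisym_space n m"
  shows "(\<Sum>a\<in>A. f a * in_y m (g a)) \<in> antisym_tensor n m"
proof -
  obtain e where e: "bij_betw e {..<card A} A"
    using ex_bij_betw_nat_finite[OF assms(1)] by (auto simp: lessThan_atLeast0)
  then have "(\<Sum>a\<in>A. f a * in_y m (g a)) = (\<Sum>k<card A. f (e k) * in_y m (g (e k)))"
    by (rule sum.reindex_bij_betw[symmetric])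
  moreover have "e k \<in> A" if "k < card A" for k
    using e that by (auto simp: bij_betw_def)
  ultimately show ?thesis
    using assms(2,3) unfolding antisym_tensor_def mem_Collect_eq
    by (intro exI[of _ "card A"] exI[of _ "f \<circ> e"] exI[of _ "g \<circ> e"]) auto
qed

section \<open>Uniqueness of the reproducing kernel\<close>

lemma int_y_sum: "int_y L m (sum f A) = (\<Sum>a\<in>A. int_y L m (f a))"
  by (simp add: int_y_def fold_int_var_sum sum_distrib_left)

lemma int_y_mult_left:
  assumes "mvars q \<subseteq> {..<m}"
  shows "int_y L m (q * F) = q * int_y L m F"
proof -
  have "mvars q \<inter> set [m..<2 * m] = {}" using assms by auto
  then show ?thesis by (simp add: int_y_def fold_int_var_mult_left mult.left_commute)
qed

lemma int_y_const:
  assumes "mvars F \<subseteq> {m..<2 * m}"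
  obtains c where "int_y L m F = mconst c"
proof -
  have "mvars (fold (int_var L) [m..<2 * m] F) = {}"
    using mvars_fold_int_var[of L "[m..<2 * m]" F] assms by auto
  then obtain d where "fold (int_var L) [m..<2 * m] F = mconst d"
    using mvars_empty_imp_mconst by blast
  then have "int_y L m F = mconst (1 / fact m * d)"
    by (simp only: int_y_def mconst_mult)
  then show thesis using that by blast
qed

text \<open>
  Write \<open>R = \<Sum>\<^sub>l a\<^sub>l(x) b\<^sub>l(y)\<close> and \<open>R' = \<Sum>\<^sub>k f\<^sub>k(x) g\<^sub>k(y)\<close>, and let \<open>B\<close> be the symmetric bilinear
  pairing on the antisymmetric polynomials. Since \<open>R\<close> reproduces \<open>g\<^sub>k\<close>,
  one has \<open>g\<^sub>k = \<Sum>\<^sub>l a\<^sub>l B(g\<^sub>k, b\<^sub>l)\<close>; inserting this into \<open>R'\<close> and using that \<open>R'\<close> reproduces \<open>b\<^sub>l\<close>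
  gives \<open>R' = \<Sum>\<^sub>l b\<^sub>l(x) a\<^sub>l(y)\<close>. The argument avoids linear independence and dimension counts.
\<close>

lemma reproducing_kernel_transpose:
  fixes N :: nat
  assumes R: "is_reproducing_kernel L n m (\<Sum>l<N. a l * in_y m (b l))"
    and ab: "\<And>l. l < N \<Longrightarrow> a l \<in> antisym_space n m" "\<And>l. l < N \<Longrightarrow> b l \<in> antisym_space n m"
    and R': "is_reproducing_kernel L n m R'"
  shows "R' = (\<Sum>l<N. b l * in_y m (a l))"
proof -
  have "R' \<in> antisym_tensor n m" using R' by (simp add: is_reproducing_kernel_def)
  then obtain M :: nat and f g where R'_eq: "R' = (\<Sum>k<M. f k * in_y m (g k))"
    and fg: "\<And>k. k < M \<Longrightarrow> f k \<in> antisym_space n m" "\<And>k. k < M \<Longrightarrow> g k \<in> antisym_space n m"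
    by (rule antisym_tensorE) (rule that)
  have vars: "mvars h \<subseteq> {..<m}" if "h \<in> antisym_space n m" for h
    using that by (simp add: antisym_space_def)
  define B where "B h h' = int_y L m (in_y m h * in_y m h')" for h h'
  have B_commute: "B h h' = B h' h" for h h'
    by (simp only: B_def mult.commute)
  have B_const: "in_y m (B h h') = B h h'"
    if "h \<in> antisym_space n m" "h' \<in> antisym_space n m" for h h'
  proof -
    have "mvars (in_y m h * in_y m h') \<subseteq> {m..<2 * m}"
      using mvars_mult mvars_in_y vars that by blast
    then obtain c where "B h h' = mconst c"
      unfolding B_def by (rule int_y_const)
    then show ?thesis by simp
  qed
  have expand: "int_y L m (in_y m h * (\<Sum>k\<in>I. u k * in_y m (v k))) = (\<Sum>k\<in>I. u k * B h (v k))"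
    if "\<And>k. k \<in> I \<Longrightarrow> u k \<in> antisym_space n m" for h u v and I :: "nat set"
  proof -
    have "int_y L m (in_y m h * (\<Sum>k\<in>I. u k * in_y m (v k))) =
        (\<Sum>k\<in>I. int_y L m (u k * (in_y m h * in_y m (v k))))"
      by (simp add: sum_distrib_left int_y_sum mult.left_commute)
    then show ?thesis using vars that by (simp add: int_y_mult_left B_def)
  qed
  have g: "in_y m (g k) = (\<Sum>l<N. in_y m (a l) * B (g k) (b l))" if "k < M" for k
  proof -
    have "g k = int_y L m (in_y m (g k) * (\<Sum>l<N. a l * in_y m (b l)))"
      using R fg(2)[OF that] unfolding is_reproducing_kernel_def by blast
    also have "\<dots> = (\<Sum>l<N. a l * B (g k) (b l))"
      using ab by (intro expand) simp
    finally have "in_y m (g k) = in_y m (\<Sum>l<N. a l * B (g k) (b l))"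
      by (rule arg_cong)
    also have "\<dots> = (\<Sum>l<N. in_y m (a l) * B (g k) (b l))"
      using ab fg that by (simp add: in_y_sum in_y_mult B_const)
    finally show ?thesis .
  qed
  have b: "(\<Sum>k<M. f k * B (b l) (g k)) = b l" if "l < N" for l
  proof -
    have "b l = int_y L m (in_y m (b l) * R')"
      using R' ab(2)[OF that] unfolding is_reproducing_kernel_def by blast
    also have "\<dots> = (\<Sum>k<M. f k * B (b l) (g k))"
      unfolding R'_eq using fg by (intro expand) simp
    finally show ?thesis by (rule sym)
  qed
  have "R' = (\<Sum>k<M. \<Sum>l<N. in_y m (a l) * (f k * B (b l) (g k)))"
    unfolding R'_eq
  proof (intro sum.cong refl)
    fix k assume "k \<in> {..<M}"
    then have "f k * in_y m (g k) = f k * (\<Sum>l<N. in_y m (a l) * B (g k) (b l))"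
      by (simp only: g lessThan_iff)
    then show "f k * in_y m (g k) = (\<Sum>l<N. in_y m (a l) * (f k * B (b l) (g k)))"
      by (simp only: sum_distrib_left mult.left_commute B_commute[of "g k"])
  qed
  also have "\<dots> = (\<Sum>l<N. in_y m (a l) * (\<Sum>k<M. f k * B (b l) (g k)))"
    by (subst sum.swap) (simp add: sum_distrib_left)
  also have "\<dots> = (\<Sum>l<N. b l * in_y m (a l))"
    by (intro sum.cong refl) (simp add: b mult.commute)
  finally show ?thesis .
qed

text \<open>
  Every reproducing kernel, \<open>R\<close> itself included, is the transpose of \<open>R\<close>.
\<close>

lemma reproducing_kernel_unique:
  assumes R: "is_reproducing_kernel L n m R" and R': "is_reproducing_kernel L n m R'"
  shows "R = R'"
proof -
  have "R \<in> antisym_tensor n m" using R by (simp add: is_reproducing_kernel_def)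
  then obtain N :: nat and a b where R_eq: "R = (\<Sum>l<N. a l * in_y m (b l))"
    and ab: "\<And>l. l < N \<Longrightarrow> a l \<in> antisym_space n m" "\<And>l. l < N \<Longrightarrow> b l \<in> antisym_space n m"
    by (rule antisym_tensorE) (rule that)
  have "R'' = (\<Sum>l<N. b l * in_y m (a l))" if "is_reproducing_kernel L n m R''" for R''
    by (rule reproducing_kernel_transpose[OF R[unfolded R_eq] ab that])
  from this[OF R] this[OF R'] show ?thesis by (rule trans[OF _ sym])
qed

lemma mvar_eq_iff [simp]: "mvar i = mvar j \<longleftrightarrow> i = j"
  by (metis mvars_mvar singleton_inject)

lemma vandermonde_nonzero: "vandermonde m \<noteq> 0"
  by (simp add: vandermonde_def)

lemma in_y_vandermonde: "in_y m (vandermonde m) = (\<Prod>j<m. \<Prod>i<j. mvar (m + j) - mvar (m + i))"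
  by (simp add: in_y_def vandermonde_def rename_vars_prod rename_vars_diff)

text \<open>
  The reproducing kernel is unique, and the two Vandermonde factors are nonzero elements of an
  integral domain, so they can be cancelled.
\<close>

lemma CD_kernel_eqI:
  assumes "mvars K \<subseteq> {..<2 * m}"
    and "is_reproducing_kernel L n m (vandermonde m * in_y m (vandermonde m) * K)"
  shows "CD_kernel L n m = K"
  unfolding CD_kernel_def
proof (rule the_equality)
  fix K'
  assume "mvars K' \<subseteq> {..<2 * m} \<and>
    is_reproducing_kernel L n m (vandermonde m * in_y m (vandermonde m) * K')"
  then have "vandermonde m * in_y m (vandermonde m) * K' = vandermonde m * in_y m (vandermonde m) * K"
    using reproducing_kernel_unique assms(2) by blast
  moreover have "in_y m (vandermonde m) \<noteq> 0"
    by (simp add: in_y_vandermonde)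
  ultimately show "K' = K" using vandermonde_nonzero[of m] by simp
qed (use assms in blast)

section \<open>Alternants of orthogonal polynomials\<close>

context orthogonal_system
begin

definition basis_product :: "nat \<Rightarrow> (nat \<Rightarrow> nat) \<Rightarrow> cmpoly" where
  "basis_product m s = (\<Prod>b<m. in_var b (p (s b)))"

text \<open>
  The determinant of the matrix with entries \<open>p (s j)\<close> at \<open>x\<^sub>i\<close> for \<open>i, j < m\<close>.
\<close>

definition alternant :: "nat \<Rightarrow> (nat \<Rightarrow> nat) \<Rightarrow> cmpoly" where
  "alternant m s = (\<Sum>\<pi> | \<pi> permutes {..<m}. of_int (sign \<pi>) * basis_product m (s \<circ> \<pi>))"

lemma basis_product_cong: "(\<And>b. b < m \<Longrightarrow> s b = t b) \<Longrightarrow> basis_product m s = basis_product m t"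
  unfolding basis_product_def by (rule prod.cong) auto

lemma alternant_cong: 
  assumes "\<And>b. b < m \<Longrightarrow> s b = t b"
  shows "alternant m s = alternant m t"
  unfolding alternant_def
proof (intro sum.cong refl arg_cong2[where f = "(*)"] basis_product_cong)
  fix \<pi> b assume "\<pi> \<in> {\<pi>. \<pi> permutes {..<m}}" "b < m"
  then have "\<pi> b < m" using permutes_in_image[of \<pi> "{..<m}" b] by simp
  then show "(s \<circ> \<pi>) b = (t \<circ> \<pi>) b" using assms by simp
qed

lemma rename_vars_basis_product:
  assumes \<rho>: "\<rho> permutes {..<m}"
  shows "rename_vars \<rho> (basis_product m (s \<circ> \<rho>)) = basis_product m s"
proof -
  have "rename_vars \<rho> (basis_product m (s \<circ> \<rho>)) = (\<Prod>b<m. in_var (\<rho> b) (p (s (\<rho> b))))"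
    by (simp add: basis_product_def rename_vars_prod)
  also have "\<dots> = basis_product m s"
    unfolding basis_product_def
    by (rule prod.reindex_bij_betw[OF permutes_imp_bij[OF \<rho>], of "\<lambda>b. in_var b (p (s b))"])
  finally show ?thesis .
qed

lemma alternant_compose:
  assumes \<rho>: "\<rho> permutes {..<m}"
  shows "alternant m (s \<circ> \<rho>) = of_int (sign \<rho>) * alternant m s"
proof -
  have "of_int (sign \<rho>) * alternant m s = of_int (sign \<rho>) *
      (\<Sum>\<pi> | \<pi> permutes {..<m}. of_int (sign (\<rho> \<circ> \<pi>)) * basis_product m (s \<circ> (\<rho> \<circ> \<pi>)))"
    unfolding alternant_def by (subst setum_permutations_compose_left[OF \<rho>]) simp
  also have "\<dots> = alternant m (s \<circ> \<rho>)"
    unfolding alternant_def sum_distrib_left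
  proof (rule sum.cong)
    fix \<pi> assume "\<pi> \<in> {\<pi>. \<pi> permutes {..<m}}"
    then have "sign (\<rho> \<circ> \<pi>) = sign \<rho> * sign \<pi>" using \<rho> sign_compose_permutes by blast
    then show "of_int (sign \<rho>) * (of_int (sign (\<rho> \<circ> \<pi>)) * basis_product m (s \<circ> (\<rho> \<circ> \<pi>))) =
        of_int (sign \<pi>) * basis_product m (s \<circ> \<rho> \<circ> \<pi>)"
      by (simp add: mult.assoc[symmetric] of_int_sign_square o_assoc)
  qed simp
  finally show ?thesis by simp
qed

text \<open>
  The antisymmetrizer permutes the variables, the alternant permutes the indices of the
  polynomials; the two differ by inverting the permutation, which does not change the sign.
\<close>

lemma antisymmetrize_basis_product: "antisymmetrize m (basis_product m s) = alternant m s"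
proof -
  have "antisymmetrize m (basis_product m s) =
      (\<Sum>\<pi> | \<pi> permutes {..<m}. of_int (sign (Hilbert_Choice.inv \<pi>)) *
        rename_vars (Hilbert_Choice.inv \<pi>) (basis_product m s))"
    unfolding antisymmetrize_def by (rule sum_permutations_inverse)
  also have "\<dots> = alternant m s"
    unfolding alternant_def
  proof (rule sum.cong)
    fix \<pi> assume "\<pi> \<in> {\<pi>. \<pi> permutes {..<m}}"
    then have \<pi>: "\<pi> permutes {..<m}" by simp
    have "rename_vars (Hilbert_Choice.inv \<pi>) (basis_product m ((s \<circ> \<pi>) \<circ> Hilbert_Choice.inv \<pi>)) =
        basis_product m (s \<circ> \<pi>)"
      by (rule rename_vars_basis_product[OF permutes_inv[OF \<pi>]])
    moreover have "(s \<circ> \<pi>) \<circ> Hilbert_Choice.inv \<pi> = s"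
      using permutes_inv_o(1)[OF \<pi>] by (simp add: o_assoc[symmetric])
    moreover have "sign (Hilbert_Choice.inv \<pi>) = sign \<pi>"
      using \<pi> by (intro sign_inverse) (auto intro: permutes_imp_permutation)
    ultimately show "of_int (sign (Hilbert_Choice.inv \<pi>)) *
        rename_vars (Hilbert_Choice.inv \<pi>) (basis_product m s) = of_int (sign \<pi>) * basis_product m (s \<circ> \<pi>)"
      by simp
  qed simp
  finally show ?thesis .
qed

text \<open>
  Exchanging two positions with equal values of \<open>s\<close> fixes \<open>s\<close> but negates the alternant.
\<close>

lemma alternant_not_inj:
  assumes "\<not> inj_on s {..<m}"
  shows "alternant m s = 0"
proof -
  obtain i j where ij: "i < m" "j < m" "i \<noteq> j" "s i = s j"
    using assms by (auto simp: inj_on_def)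
  let ?\<rho> = "Transposition.transpose i j"
  have \<rho>: "?\<rho> permutes {..<m}" using ij by (intro permutes_swap_id) auto
  have "s \<circ> ?\<rho> = s" using ij by (auto simp: fun_eq_iff Transposition.transpose_def)
  then have "alternant m s = - alternant m s"
    using alternant_compose[OF \<rho>, of s] ij(3) by (simp only: sign_swap_id) simp
  then have "2 * alternant m s = 0"
    unfolding mult_2 by (simp only: eq_neg_iff_add_eq_0)
  then show ?thesis by simp
qed

lemma alternant_in_antisym_space:
  assumes s: "\<And>b. b < m \<Longrightarrow> s b < n"
  shows "alternant m s \<in> antisym_space n m"
proof -
  have vars: "mvars (basis_product m t) \<subseteq> {..<m}" for t
    unfolding basis_product_def using mvars_in_var by (intro mvars_prod) blast
  have pair: "of_int (sign \<pi>) * q = mconst (of_int (sign \<pi>)) * q" for \<pi> :: "nat \<Rightarrow> nat" and q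
    by (simp add: mconst_of_int)
  have "mvars (alternant m s) \<subseteq> {..<m}"
    unfolding alternant_def pair using mvars_mult vars by (intro mvars_sum) fastforce
  moreover have "antisymmetric_in m (alternant m s)"
    unfolding antisymmetric_in_def
  proof safe
    fix \<rho> :: "nat \<Rightarrow> nat" assume \<rho>: "\<rho> permutes {..<m}"
    have "rename_vars \<rho> (alternant m s) = rename_vars \<rho>
        (\<Sum>\<pi> | \<pi> permutes {..<m}. of_int (sign (\<pi> \<circ> \<rho>)) * basis_product m ((s \<circ> \<pi>) \<circ> \<rho>))"
      unfolding alternant_def by (subst sum_permutations_compose_right[OF \<rho>]) (simp add: o_assoc)
    also have "\<dots> = (\<Sum>\<pi> | \<pi> permutes {..<m}. of_int (sign (\<pi> \<circ> \<rho>)) * basis_product m (s \<circ> \<pi>))"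
      by (simp add: rename_vars_sum rename_vars_mult rename_vars_basis_product[OF \<rho>])
    also have "\<dots> = of_int (sign \<rho>) * alternant m s"
      unfolding alternant_def sum_distrib_left
      using \<rho> by (intro sum.cong refl) (simp add: sign_compose_permutes mult_ac)
    finally show "rename_vars \<rho> (alternant m s) = of_int (sign \<rho>) * alternant m s" .
  qed
  moreover have "Poly_Mapping.lookup \<alpha> i < n"
    if \<alpha>: "\<alpha> \<in> Poly_Mapping.keys (alternant m s)" and i: "i < m" for \<alpha> i
  proof -
    obtain \<pi> where \<pi>: "\<pi> permutes {..<m}"
      and "\<alpha> \<in> Poly_Mapping.keys (of_int (sign \<pi>) * basis_product m (s \<circ> \<pi>))"
      using \<alpha> Poly_Mapping.keys_sum unfolding alternant_def by fastforce
    then have "\<alpha> \<in> Poly_Mapping.keys (basis_product m (s \<circ> \<pi>))"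
      unfolding pair using keys_mconst_mult by blast
    then have "Poly_Mapping.lookup \<alpha> i \<le> degree (p ((s \<circ> \<pi>) i))"
      unfolding basis_product_def using i by (intro keys_prod_in_var) auto
    also have "\<dots> \<le> s (\<pi> i)" using deg by simp
    also have "\<dots> < n" using s permutes_in_image[OF \<pi>, of i] i by simp
    finally show ?thesis .
  qed
  ultimately show ?thesis by (auto simp: antisym_space_def)
qed

text \<open>
  Each power \<open>x\<^sub>b^k\<close> with \<open>k < n\<close> is a combination of \<open>p\<^sub>0, ..., p\<^sub>n\<^sub>-\<^sub>1\<close> in \<open>x\<^sub>b\<close>; multiplying out the
  product over \<open>b < m\<close> gives one summand for each function \<open>s\<close> from \<open>{..<m}\<close> to \<open>{..<n}\<close>.
\<close>

lemma basis_products_span: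
  assumes vars: "mvars f \<subseteq> {..<m}"
    and deg_f: "\<forall>\<alpha>\<in>Poly_Mapping.keys f. \<forall>i<m. Poly_Mapping.lookup \<alpha> i < n"
  shows "\<exists>a. f = (\<Sum>s\<in>{..<m} \<rightarrow>\<^sub>E {..<n}. mconst (a s) * basis_product m s)"
proof -
  have "\<exists>d. monom 1 k = (\<Sum>j<n. smult (d j) (p j))" if "k < n" for k
    using that by (intro monic_family_spans) (auto simp: deg monic)
  then obtain d where d: "monom 1 k = (\<Sum>j<n. smult (d k j) (p j))" if "k < n" for k
    by metis
  have mono: "Poly_Mapping.single \<alpha> c = (\<Sum>s\<in>{..<m} \<rightarrow>\<^sub>E {..<n}.
      mconst (c * (\<Prod>b<m. d (Poly_Mapping.lookup \<alpha> b) (s b))) * basis_product m s)"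
    if \<alpha>: "\<alpha> \<in> Poly_Mapping.keys f" for \<alpha> c
  proof -
    have sub: "Poly_Mapping.keys \<alpha> \<subseteq> {..<m}"
      using vars \<alpha> by (auto simp: mvars_def)
    have "(\<Prod>b<k. mvar b ^ Poly_Mapping.lookup \<alpha> b) =
        Poly_Mapping.single (\<Sum>b<k. Poly_Mapping.single b (Poly_Mapping.lookup \<alpha> b)) 1" for k
      by (induction k) (auto simp: mvar_power mult_single)
    moreover have "(\<Sum>b<m. Poly_Mapping.single b (Poly_Mapping.lookup \<alpha> b)) = \<alpha>"
    proof (rule poly_mapping_eqI)
      fix i
      have "Poly_Mapping.lookup (\<Sum>b<m. Poly_Mapping.single b (Poly_Mapping.lookup \<alpha> b)) i =
          (\<Sum>b<m. if i = b then Poly_Mapping.lookup \<alpha> b else 0)"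
        by (auto simp: lookup_sum lookup_single when_def intro!: sum.cong)
      also have "\<dots> = Poly_Mapping.lookup \<alpha> i" using sub by (auto simp: in_keys_iff)
      finally show "Poly_Mapping.lookup (\<Sum>b<m. Poly_Mapping.single b (Poly_Mapping.lookup \<alpha> b)) i =
          Poly_Mapping.lookup \<alpha> i" .
    qed
    ultimately have "Poly_Mapping.single \<alpha> c = mconst c * (\<Prod>b<m. mvar b ^ Poly_Mapping.lookup \<alpha> b)"
      by (simp add: mconst_mult_single)
    also have "(\<Prod>b<m. mvar b ^ Poly_Mapping.lookup \<alpha> b) =
        (\<Prod>b<m. \<Sum>j<n. mconst (d (Poly_Mapping.lookup \<alpha> b) j) * in_var b (p j))"
    proof (rule prod.cong)
      fix b assume "b \<in> {..<m}"
      then have "monom 1 (Poly_Mapping.lookup \<alpha> b) =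
          (\<Sum>j<n. smult (d (Poly_Mapping.lookup \<alpha> b) j) (p j))"
        using deg_f \<alpha> by (intro d) auto
      from arg_cong[OF this, of "in_var b"]
      show "mvar b ^ Poly_Mapping.lookup \<alpha> b =
          (\<Sum>j<n. mconst (d (Poly_Mapping.lookup \<alpha> b) j) * in_var b (p j))"
        by (simp add: in_var_monom in_var_sum in_var_smult)
    qed simp
    also have "\<dots> = (\<Sum>s\<in>{..<m} \<rightarrow>\<^sub>E {..<n}.
        \<Prod>b<m. mconst (d (Poly_Mapping.lookup \<alpha> b) (s b)) * in_var b (p (s b)))"
      by (rule prod_sum_PiE) auto
    finally show ?thesis
      by (simp add: sum_distrib_left prod.distrib basis_product_def mconst_mult mconst_prod mult.assoc)
  qed
  define a where "a s = (\<Sum>\<alpha>\<in>Poly_Mapping.keys f. Poly_Mapping.lookup f \<alpha> *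
      (\<Prod>b<m. d (Poly_Mapping.lookup \<alpha> b) (s b)))" for s
  have "f = (\<Sum>\<alpha>\<in>Poly_Mapping.keys f. \<Sum>s\<in>{..<m} \<rightarrow>\<^sub>E {..<n}.
      mconst (Poly_Mapping.lookup f \<alpha> * (\<Prod>b<m. d (Poly_Mapping.lookup \<alpha> b) (s b))) * basis_product m s)"
    by (subst cmpoly_as_sum[of f, symmetric]) (intro sum.cong refl mono)
  also have "\<dots> = (\<Sum>s\<in>{..<m} \<rightarrow>\<^sub>E {..<n}. mconst (a s) * basis_product m s)"
    unfolding a_def mconst_sum sum_distrib_right by (rule sum.swap)
  finally show ?thesis by blast
qed

lemma int_y_basis_products:
  "int_y L m (in_y m (basis_product m s) * in_y m (basis_product m t)) =
     mconst (1 / fact m * (\<Prod>b<m. L (p (s b) * p (t b))))"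
proof -
  have shift: "(\<Prod>b<m. h b) = (\<Prod>c\<in>set [m..<2 * m]. h (c - m))" for h :: "nat \<Rightarrow> 'b :: comm_monoid_mult"
    by (rule prod.reindex_bij_witness[of _ "\<lambda>c. c - m" "\<lambda>b. m + b"]) auto
  have "in_y m (basis_product m s) * in_y m (basis_product m t) =
      (\<Prod>b<m. in_var (m + b) (p (s b) * p (t b)))"
    by (simp add: basis_product_def in_y_def rename_vars_prod in_var_mult prod.distrib)
  also have "\<dots> = 1 * (\<Prod>c\<in>set [m..<2 * m]. in_var c (p (s (c - m)) * p (t (c - m))))"
    unfolding shift by (auto intro!: prod.cong)
  also have "fold (int_var L) [m..<2 * m] \<dots> =
      1 * mconst (\<Prod>c\<in>set [m..<2 * m]. L (p (s (c - m)) * p (t (c - m))))"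
    by (rule fold_int_var_prod_in_var[OF lin]) auto
  also have "\<dots> = mconst (\<Prod>b<m. L (p (s b) * p (t b)))"
    unfolding shift by simp
  finally show ?thesis by (simp only: int_y_def mconst_mult)
qed

lemma prod_orthogonality:
  assumes "finite A"
  shows "(\<Prod>b\<in>A. L (p (s b) * p (t b))) =
    (if \<forall>b\<in>A. s b = t b then \<Prod>b\<in>A. L (p (t b) * p (t b)) else 0)"
  using assms orth by (auto intro!: prod.cong prod_zero)

lemma renamed_vandermonde_eq_sum:
  "renamed_vandermonde n u =
     (\<Sum>\<sigma> | \<sigma> permutes {..<n}. of_int (sign \<sigma>) * (\<Prod>b<n. in_var (u b) (p (\<sigma> b))))"
proof -
  have "degree (map_poly mconst (p k)) \<le> k" for k
    using deg[of k] by (intro degree_le) (auto simp: coeff_map_poly coeff_eq_0)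
  moreover have "poly.coeff (map_poly mconst (p k)) k = 1" for k
    by (simp add: coeff_map_poly monic)
  ultimately show ?thesis
    unfolding renamed_vandermonde_def in_var_def by (rule vandermonde_product_eq_det)
qed

section \<open>The integrated product of two Vandermonde determinants\<close>

text \<open>
  The squared norms that are left over from the \<open>n - m\<close> integrated variables.
\<close>

definition kernel_weight :: "nat \<Rightarrow> nat \<Rightarrow> (nat \<Rightarrow> nat) \<Rightarrow> complex" where
  "kernel_weight m n \<tau> = (\<Prod>b\<in>{m..<n}. L (p (\<tau> b) * p (\<tau> b)))"

text \<open>
  The \<open>n - m\<close> integration variables \<open>w\<close> have the indices \<open>2 * m, ..., m + n - 1\<close>. With this choice
  \<open>(y, w)\<close> is enumerated by \<open>b \<mapsto> m + b\<close>, and \<open>(x, w)\<close> by the same map from \<open>b = m\<close> on.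
  Both determinants are expanded over permutations \<open>\<sigma>\<close> and \<open>\<tau>\<close>. Orthogonality in \<open>w\<close> leaves only the
  pairs that agree on \<open>{m..<n}\<close>, and for fixed \<open>\<tau>\<close> the sum over these \<open>\<sigma>\<close> is an alternant in \<open>x\<close>.
\<close>

lemma integrated_vandermonde_product:
  assumes mn: "m \<le> n"
  shows "fold (int_var L) [2 * m..<m + n]
      (renamed_vandermonde n (\<lambda>b. if b < m then b else m + b) * renamed_vandermonde n (\<lambda>b. m + b)) =
    (\<Sum>\<tau> | \<tau> permutes {..<n}.
      mconst (kernel_weight m n \<tau>) * alternant m \<tau> * in_y m (basis_product m \<tau>))"
proof -
  let ?S = "{\<sigma>. \<sigma> permutes {..<n}}"
  let ?ux = "\<lambda>b. if b < m then b else m + b"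
  have split: "(\<Prod>b<n. h b) = (\<Prod>b<m. h b) * (\<Prod>b\<in>{m..<n}. h b)" for h :: "nat \<Rightarrow> 'b :: comm_monoid_mult"
    using mn by (subst prod.union_disjoint[symmetric]) (auto intro: prod.cong)
  have shift: "(\<Prod>b\<in>{m..<n}. h b) = (\<Prod>c\<in>set [2 * m..<m + n]. h (c - m))" for h :: "nat \<Rightarrow> 'b :: comm_monoid_mult"
    by (rule prod.reindex_bij_witness[of _ "\<lambda>c. c - m" "\<lambda>b. m + b"]) auto
  have pair: "fold (int_var L) [2 * m..<m + n]
        ((\<Prod>b<n. in_var (?ux b) (p (\<sigma> b))) * (\<Prod>b<n. in_var (m + b) (p (\<tau> b)))) =
      basis_product m \<sigma> * in_y m (basis_product m \<tau>) * mconst (\<Prod>b\<in>{m..<n}. L (p (\<sigma> b) * p (\<tau> b)))"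
    for \<sigma> \<tau>
  proof -
    have x: "(\<Prod>b<n. in_var (?ux b) (p (\<sigma> b))) =
        basis_product m \<sigma> * (\<Prod>b\<in>{m..<n}. in_var (m + b) (p (\<sigma> b)))"
      unfolding split basis_product_def by (intro arg_cong2[where f = "(*)"] prod.cong) auto
    have y: "(\<Prod>b<n. in_var (m + b) (p (\<tau> b))) =
        in_y m (basis_product m \<tau>) * (\<Prod>b\<in>{m..<n}. in_var (m + b) (p (\<tau> b)))"
      unfolding split by (simp add: basis_product_def in_y_def rename_vars_prod)
    have w: "(\<Prod>b\<in>{m..<n}. in_var (m + b) (p (\<sigma> b))) * (\<Prod>b\<in>{m..<n}. in_var (m + b) (p (\<tau> b))) =
        (\<Prod>c\<in>set [2 * m..<m + n]. in_var c (p (\<sigma> (c - m)) * p (\<tau> (c - m))))"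
      unfolding prod.distrib[symmetric] in_var_mult[symmetric] shift by (auto intro!: prod.cong)
    have "mvars (basis_product m t) \<subseteq> {..<m}" for t
      unfolding basis_product_def using mvars_in_var by (intro mvars_prod) blast
    then have "mvars (basis_product m \<sigma> * in_y m (basis_product m \<tau>)) \<subseteq> {..<m} \<union> {m..<2 * m}"
      using mvars_mult mvars_in_y by blast
    then have "mvars (basis_product m \<sigma> * in_y m (basis_product m \<tau>)) \<inter> set [2 * m..<m + n] = {}"
      by auto
    from fold_int_var_prod_in_var[OF lin _ this, of "\<lambda>c. p (\<sigma> (c - m)) * p (\<tau> (c - m))"]
    have "fold (int_var L) [2 * m..<m + n] (basis_product m \<sigma> * in_y m (basis_product m \<tau>) *
          (\<Prod>c\<in>set [2 * m..<m + n]. in_var c (p (\<sigma> (c - m)) * p (\<tau> (c - m))))) =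
        basis_product m \<sigma> * in_y m (basis_product m \<tau>) *
          mconst (\<Prod>b\<in>{m..<n}. L (p (\<sigma> b) * p (\<tau> b)))"
      unfolding shift by simp
    then show ?thesis unfolding x y w[symmetric] by (simp only: mult_ac)
  qed
  have inner: "(\<Sum>\<sigma>\<in>?S. of_int (sign \<sigma>) * of_int (sign \<tau>) *
        (basis_product m \<sigma> * in_y m (basis_product m \<tau>) * mconst (\<Prod>b\<in>{m..<n}. L (p (\<sigma> b) * p (\<tau> b))))) =
      mconst (kernel_weight m n \<tau>) * alternant m \<tau> * in_y m (basis_product m \<tau>)"
    if \<tau>: "\<tau> permutes {..<n}" for \<tau>
  proof -
    let ?F = "\<lambda>\<sigma>. of_int (sign \<sigma>) * of_int (sign \<tau>) *
        (basis_product m \<sigma> * in_y m (basis_product m \<tau>) * mconst (kernel_weight m n \<tau>))"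
    have "(\<Sum>\<sigma>\<in>?S. of_int (sign \<sigma>) * of_int (sign \<tau>) *
        (basis_product m \<sigma> * in_y m (basis_product m \<tau>) * mconst (\<Prod>b\<in>{m..<n}. L (p (\<sigma> b) * p (\<tau> b))))) =
      (\<Sum>\<sigma>\<in>?S. if \<forall>b\<in>{m..<n}. \<sigma> b = \<tau> b then ?F \<sigma> else 0)"
      by (intro sum.cong refl, subst prod_orthogonality) (simp_all add: kernel_weight_def)
    also have "\<dots> = (\<Sum>\<sigma> | \<sigma> permutes {..<n} \<and> (\<forall>b\<in>{m..<n}. \<sigma> b = \<tau> b). ?F \<sigma>)"
      by (subst sum.inter_filter[symmetric]) (simp_all add: finite_permutations)
    also have "\<dots> = (\<Sum>\<pi> | \<pi> permutes {..<m}. ?F (\<tau> \<circ> \<pi>))"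
      by (rule sum_permutations_agreeing_outside[OF \<tau> mn])
    also have "\<dots> = (\<Sum>\<pi> | \<pi> permutes {..<m}. mconst (kernel_weight m n \<tau>) *
        (of_int (sign \<pi>) * basis_product m (\<tau> \<circ> \<pi>)) * in_y m (basis_product m \<tau>))"
    proof (rule sum.cong)
      fix \<pi> assume "\<pi> \<in> {\<pi>. \<pi> permutes {..<m}}"
      then have "of_int (sign (\<tau> \<circ> \<pi>)) * of_int (sign \<tau>) = (of_int (sign \<pi>) :: cmpoly)"
        using \<tau> by (simp add: sign_compose_permutes[of \<tau> n \<pi> m] mult.commute[of "of_int (sign \<tau>)"]
            mult.assoc of_int_sign_square)
      then show "?F (\<tau> \<circ> \<pi>) = mconst (kernel_weight m n \<tau>) *
          (of_int (sign \<pi>) * basis_product m (\<tau> \<circ> \<pi>)) * in_y m (basis_product m \<tau>)"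
        by (simp only: mult_ac)
    qed simp
    finally show ?thesis
      by (simp only: alternant_def sum_distrib_left sum_distrib_right)
  qed
  have "fold (int_var L) [2 * m..<m + n]
      (renamed_vandermonde n ?ux * renamed_vandermonde n (\<lambda>b. m + b)) =
    (\<Sum>\<sigma>\<in>?S. \<Sum>\<tau>\<in>?S. fold (int_var L) [2 * m..<m + n] (of_int (sign \<sigma>) * of_int (sign \<tau>) *
      ((\<Prod>b<n. in_var (?ux b) (p (\<sigma> b))) * (\<Prod>b<n. in_var (m + b) (p (\<tau> b))))))"
    unfolding renamed_vandermonde_eq_sum sum_product fold_int_var_sum by (simp only: mult_ac)
  also have "\<dots> = (\<Sum>\<sigma>\<in>?S. \<Sum>\<tau>\<in>?S. of_int (sign \<sigma>) * of_int (sign \<tau>) *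
        (basis_product m \<sigma> * in_y m (basis_product m \<tau>) * mconst (\<Prod>b\<in>{m..<n}. L (p (\<sigma> b) * p (\<tau> b)))))"
  proof -
    have "mvars (of_int k * of_int l :: cmpoly) = {}" for k l
      using mvars_of_int[of "k * l"] by (simp only: of_int_mult)
    then show ?thesis by (simp add: fold_int_var_mult_left pair)
  qed
  also have "\<dots> = (\<Sum>\<tau>\<in>?S. mconst (kernel_weight m n \<tau>) * alternant m \<tau> * in_y m (basis_product m \<tau>))"
    by (subst sum.swap) (intro sum.cong refl inner, simp)
  finally show ?thesis .
qed

end

section \<open>A manifestly symmetric integrand\<close>

lemma mvars_vandermonde: "mvars (vandermonde m) \<subseteq> {..<m}"
  unfolding vandermonde_def
proof (intro mvars_prod)
  fix i j assume "j \<in> {..<m}" "i \<in> {..<j}"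
  then show "mvars (mvar j - mvar i) \<subseteq> {..<m}"
    using mvars_diff[of "mvar j" "mvar i"] by auto
qed

text \<open>
  In the notation \<open>z = (x, y)\<close> this is \<open>\<Delta>(w)\<^sup>2 \<Prod>\<^sub>j \<Prod>\<^sub>i (w\<^sub>j - z\<^sub>i)\<close>, in which all \<open>2 * m\<close> variables \<open>z\<^sub>i\<close>
  enter in the same way. The variable \<open>w\<close> that belongs to \<open>j \<in> {m..<n}\<close> has index \<open>m + j\<close>.
\<close>

definition symmetric_integrand :: "nat \<Rightarrow> nat \<Rightarrow> cmpoly" where
  "symmetric_integrand m n =
     (\<Prod>j\<in>{m..<n}. (\<Prod>i<2 * m. mvar (m + j) - mvar i) * (\<Prod>i\<in>{m..<j}. mvar (m + j) - mvar (m + i))\<^sup>2)"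

text \<open>
  Every factor of \<open>\<Delta>(x, w) \<Delta>(y, w)\<close> is a difference of two \<open>x\<close>, of two \<open>y\<close>, of a \<open>w\<close> and an \<open>x\<close> or
  \<open>y\<close>, or of two \<open>w\<close>; differences of the last kind occur twice. As \<open>w\<close> comes last in both
  tuples, there are no signs.
\<close>

lemma vandermonde_product_factorization:
  assumes mn: "m \<le> n"
  shows "renamed_vandermonde n (\<lambda>b. if b < m then b else m + b) * renamed_vandermonde n (\<lambda>b. m + b) =
    vandermonde m * in_y m (vandermonde m) * symmetric_integrand m n"
proof -
  have split: "renamed_vandermonde n u = renamed_vandermonde m u *
      (\<Prod>j\<in>{m..<n}. (\<Prod>i<m. mvar (u j) - mvar (u i)) * (\<Prod>i\<in>{m..<j}. mvar (u j) - mvar (u i)))" for u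
  proof -
    have cut: "(\<Prod>b<k. h b) = (\<Prod>b<m. h b) * (\<Prod>b\<in>{m..<k}. h b)"
      if "m \<le> k" for h :: "nat \<Rightarrow> cmpoly" and k
      using that by (subst prod.union_disjoint[symmetric]) (auto intro: prod.cong)
    have "(\<Prod>j\<in>{m..<n}. \<Prod>i<j. mvar (u j) - mvar (u i)) =
        (\<Prod>j\<in>{m..<n}. (\<Prod>i<m. mvar (u j) - mvar (u i)) * (\<Prod>i\<in>{m..<j}. mvar (u j) - mvar (u i)))"
      by (intro prod.cong refl cut) simp
    then show ?thesis
      unfolding renamed_vandermonde_def cut[OF mn, of "\<lambda>j. \<Prod>i<j. mvar (u j) - mvar (u i)"] by simp
  qed
  have double: "(\<Prod>i<2 * m. h i) = (\<Prod>i<m. h i) * (\<Prod>i<m. h (m + i))" for h :: "nat \<Rightarrow> cmpoly"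
  proof -
    have "(\<Prod>i\<in>{m..<2 * m}. h i) = (\<Prod>i<m. h (m + i))"
      by (rule prod.reindex_bij_witness[of _ "\<lambda>b. m + b" "\<lambda>c. c - m"]) auto
    moreover have "(\<Prod>i<2 * m. h i) = (\<Prod>i<m. h i) * (\<Prod>i\<in>{m..<2 * m}. h i)"
      by (subst prod.union_disjoint[symmetric]) (auto intro: prod.cong)
    ultimately show ?thesis by simp
  qed
  have x: "renamed_vandermonde n (\<lambda>b. if b < m then b else m + b) = vandermonde m *
      (\<Prod>j\<in>{m..<n}. (\<Prod>i<m. mvar (m + j) - mvar i) * (\<Prod>i\<in>{m..<j}. mvar (m + j) - mvar (m + i)))"
    unfolding split unfolding renamed_vandermonde_def vandermonde_def
    by (intro arg_cong2[where f = "(*)"] prod.cong refl) auto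
  have y: "renamed_vandermonde n (\<lambda>b. m + b) = in_y m (vandermonde m) *
      (\<Prod>j\<in>{m..<n}. (\<Prod>i<m. mvar (m + j) - mvar (m + i)) * (\<Prod>i\<in>{m..<j}. mvar (m + j) - mvar (m + i)))"
    unfolding split unfolding in_y_vandermonde renamed_vandermonde_def ..
  show ?thesis
    unfolding x y symmetric_integrand_def double power2_eq_square
    by (simp only: prod.distrib mult_ac)
qed

lemma rename_vars_symmetric_integrand:
  assumes \<sigma>: "\<sigma> permutes {..<2 * m}"
  shows "rename_vars \<sigma> (symmetric_integrand m n) = symmetric_integrand m n"
proof -
  have fixed: "\<sigma> (m + j) = m + j" if "m \<le> j" for j
    using permutes_not_in[OF \<sigma>, of "m + j"] that by simp
  have "(\<Prod>i<2 * m. mvar k - mvar (\<sigma> i)) = (\<Prod>i<2 * m. mvar k - mvar i)" for k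
    by (rule prod.reindex_bij_betw[OF permutes_imp_bij[OF \<sigma>], of "\<lambda>i. mvar k - mvar i"])
  then show ?thesis
    unfolding symmetric_integrand_def
    by (auto simp: rename_vars_prod rename_vars_mult rename_vars_power rename_vars_diff fixed
        intro!: prod.cong)
qed

lemma mvars_symmetric_integrand: "mvars (symmetric_integrand m n) \<subseteq> {..<m + n}"
proof -
  have diff: "mvars (mvar a - mvar b) \<subseteq> {..<m + n}" if "a < m + n" "b < m + n" for a b
    using mvars_diff[of "mvar a" "mvar b"] that by auto
  show ?thesis
    unfolding symmetric_integrand_def
    by (intro mvars_prod order.trans[OF mvars_mult] Un_least order.trans[OF mvars_power] diff) auto
qed

section \<open>The Christoffel-Darboux kernel as an integral\<close>

context orthogonal_system
begin

text \<open>
  The value of the integral in \<open>integrated_vandermonde_product\<close>. It is antisymmetric in \<open>y\<close> as a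
  whole although the single summands are not; this form makes the reproducing property a direct
  consequence of orthogonality.
\<close>

definition reproducing_sum :: "nat \<Rightarrow> nat \<Rightarrow> cmpoly" where
  "reproducing_sum n m = (\<Sum>\<tau> | \<tau> permutes {..<n}.
      mconst (kernel_weight m n \<tau>) * alternant m \<tau> * in_y m (basis_product m \<tau>))"

text \<open>
  Replacing \<open>\<tau>\<close> by \<open>\<tau> \<circ> \<pi>\<close> for a permutation \<open>\<pi>\<close> of \<open>{..<m}\<close> moves the sign of \<open>\<pi>\<close> from the alternant
  to the factor in \<open>y\<close>. Averaging over all \<open>\<pi>\<close> turns the latter into an alternant too.
\<close>

lemma reproducing_sum_in_antisym_tensor:
  assumes mn: "m \<le> n"
  shows "mconst c * reproducing_sum n m \<in> antisym_tensor n m"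
proof -
  let ?S = "{\<tau>. \<tau> permutes {..<n}}" and ?P = "{\<pi>. \<pi> permutes {..<m}}"
  let ?t = "\<lambda>\<tau>. mconst (kernel_weight m n \<tau>) * alternant m \<tau> * in_y m (basis_product m \<tau>)"
  have "reproducing_sum n m = (\<Sum>\<tau>\<in>?S. mconst (kernel_weight m n \<tau>) * alternant m \<tau> *
      in_y m (of_int (sign \<pi>) * basis_product m (\<tau> \<circ> \<pi>)))" if \<pi>: "\<pi> permutes {..<m}" for \<pi>
  proof -
    have "\<pi> permutes {..<n}" using \<pi> mn by (auto intro: permutes_subset)
    then have "reproducing_sum n m = (\<Sum>\<tau>\<in>?S. ?t (\<tau> \<circ> \<pi>))"
      unfolding reproducing_sum_def by (rule sum_permutations_compose_right)
    also have "\<dots> = (\<Sum>\<tau>\<in>?S. mconst (kernel_weight m n \<tau>) * alternant m \<tau> *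
        in_y m (of_int (sign \<pi>) * basis_product m (\<tau> \<circ> \<pi>)))"
    proof (intro sum.cong refl)
      fix \<tau>
      have "kernel_weight m n (\<tau> \<circ> \<pi>) = kernel_weight m n \<tau>"
        unfolding kernel_weight_def using permutes_not_in[OF \<pi>] by (intro prod.cong) auto
      then show "?t (\<tau> \<circ> \<pi>) = mconst (kernel_weight m n \<tau>) * alternant m \<tau> *
          in_y m (of_int (sign \<pi>) * basis_product m (\<tau> \<circ> \<pi>))"
        unfolding alternant_compose[OF \<pi>] in_y_mult by (simp add: in_y_def mult_ac)
    qed
    finally show ?thesis .
  qed
  then have "(\<Sum>\<pi>\<in>?P. reproducing_sum n m) = (\<Sum>\<pi>\<in>?P. \<Sum>\<tau>\<in>?S. mconst (kernel_weight m n \<tau>) *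
      alternant m \<tau> * in_y m (of_int (sign \<pi>) * basis_product m (\<tau> \<circ> \<pi>)))"
    by (intro sum.cong) auto
  also have "\<dots> = (\<Sum>\<tau>\<in>?S. mconst (kernel_weight m n \<tau>) * alternant m \<tau> * in_y m (alternant m \<tau>))"
    by (subst sum.swap) (simp only: alternant_def[of m] in_y_sum sum_distrib_left)
  also have "(\<Sum>\<pi>\<in>?P. reproducing_sum n m) = mconst (fact m) * reproducing_sum n m"
    using card_permutations[of "{..<m}" m]
    by (simp only: sum_constant card_lessThan finite_lessThan mconst_of_nat[symmetric] of_nat_fact)
  finally have "mconst (c / fact m) * (mconst (fact m) * reproducing_sum n m) =
      (\<Sum>\<tau>\<in>?S. (mconst (c / fact m * kernel_weight m n \<tau>) * alternant m \<tau>) * in_y m (alternant m \<tau>))"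
    by (simp only: sum_distrib_left mconst_mult mult.assoc)
  moreover have "mconst (c / fact m) * (mconst (fact m) * reproducing_sum n m) =
      mconst c * reproducing_sum n m"
    unfolding mult.assoc[symmetric] mconst_mult[symmetric] by simp
  moreover have "alternant m \<tau> \<in> antisym_space n m" if "\<tau> \<in> ?S" for \<tau>
  proof (rule alternant_in_antisym_space)
    show "\<tau> b < n" if "b < m" for b
      using \<open>\<tau> \<in> ?S\<close> permutes_in_image[of \<tau> "{..<n}" b] that mn by simp
  qed
  ultimately show ?thesis
    by (simp only:) (intro antisym_tensor_finite_sum antisym_space_mconst_mult finite_permutations;
        simp)
qed

text \<open>
  Orthogonality in \<open>y\<close> keeps the \<open>\<tau>\<close> that extend \<open>s\<close>. Each of them contributes the same multiple of
  the alternant of \<open>s\<close>, since the norms from \<open>y\<close> and those in the weight combine to the full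
  product. There are \<open>(n - m)!\<close> such \<open>\<tau>\<close>, or none if \<open>s\<close> is not injective, and then the
  alternant vanishes as well.
\<close>

lemma int_y_basis_product_reproducing_sum:
  assumes mn: "m \<le> n" and s: "\<And>b. b < m \<Longrightarrow> s b < n"
  shows "int_y L m (in_y m (basis_product m s) * reproducing_sum n m) =
    mconst ((\<Prod>k<n. L (p k * p k)) * fact (n - m) / fact m) * alternant m s"
proof -
  let ?S = "{\<tau>. \<tau> permutes {..<n}}" and ?H = "\<Prod>k<n. L (p k * p k)"
  have "int_y L m (in_y m (basis_product m s) * reproducing_sum n m) =
      (\<Sum>\<tau>\<in>?S. int_y L m ((mconst (kernel_weight m n \<tau>) * alternant m \<tau>) *
        (in_y m (basis_product m s) * in_y m (basis_product m \<tau>))))"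
    unfolding reproducing_sum_def sum_distrib_left int_y_sum by (simp only: mult_ac)
  also have "\<dots> = (\<Sum>\<tau>\<in>?S. if \<forall>b<m. \<tau> b = s b then mconst (?H / fact m) * alternant m s else 0)"
  proof (intro sum.cong refl)
    fix \<tau> assume "\<tau> \<in> ?S"
    then have \<tau>: "\<tau> permutes {..<n}" by simp
    have "alternant m \<tau> \<in> antisym_space n m"
    proof (rule alternant_in_antisym_space)
      show "\<tau> b < n" if "b < m" for b
        using permutes_in_image[OF \<tau>, of b] that mn by simp
    qed
    then have "mvars (mconst (kernel_weight m n \<tau>) * alternant m \<tau>) \<subseteq> {..<m}"
      using antisym_space_mconst_mult[of _ n m] by (simp add: antisym_space_def)
    then have "int_y L m ((mconst (kernel_weight m n \<tau>) * alternant m \<tau>) *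
        (in_y m (basis_product m s) * in_y m (basis_product m \<tau>))) =
      mconst (kernel_weight m n \<tau>) * alternant m \<tau> * mconst (1 / fact m * (\<Prod>b<m. L (p (s b) * p (\<tau> b))))"
      by (simp only: int_y_mult_left int_y_basis_products)
    also have "\<dots> = mconst (kernel_weight m n \<tau> * (\<Prod>b<m. L (p (s b) * p (\<tau> b))) / fact m) * alternant m \<tau>"
      by (simp add: mconst_mult[symmetric] mult.commute mult.left_commute)
    also have "\<dots> = (if \<forall>b<m. \<tau> b = s b then mconst (?H / fact m) * alternant m s else 0)"
    proof (cases "\<forall>b<m. \<tau> b = s b")
      case True
      have "(\<Prod>b<m. L (p (s b) * p (\<tau> b))) = (\<Prod>b<m. L (p (\<tau> b) * p (\<tau> b)))"
        using True by (intro prod.cong) auto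
      moreover have "kernel_weight m n \<tau> * (\<Prod>b<m. L (p (\<tau> b) * p (\<tau> b))) = (\<Prod>b<n. L (p (\<tau> b) * p (\<tau> b)))"
        unfolding kernel_weight_def using mn
        by (subst prod.union_disjoint[symmetric]) (auto intro: prod.cong)
      moreover have "(\<Prod>b<n. L (p (\<tau> b) * p (\<tau> b))) = ?H"
        by (rule prod.reindex_bij_betw[OF permutes_imp_bij[OF \<tau>], of "\<lambda>k. L (p k * p k)"])
      moreover have "alternant m \<tau> = alternant m s"
        using True by (intro alternant_cong) simp
      ultimately show ?thesis using True by simp
    next
      case False
      then have zero: "(\<Prod>b<m. L (p (s b) * p (\<tau> b))) = 0"
        by (subst prod_orthogonality) auto
      show ?thesis by (simp only: zero if_not_P[OF False]) simp
    qed
    finally show "int_y L m ((mconst (kernel_weight m n \<tau>) * alternant m \<tau>) *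
        (in_y m (basis_product m s) * in_y m (basis_product m \<tau>))) = 
        (if \<forall>b<m. \<tau> b = s b then mconst (?H / fact m) * alternant m s else 0)" .
  qed
  also have "\<dots> = (\<Sum>\<tau> | \<tau> permutes {..<n} \<and> (\<forall>b<m. \<tau> b = s b). mconst (?H / fact m) * alternant m s)"
    by (subst sum.inter_filter[symmetric]) (simp_all add: finite_permutations)
  also have "\<dots> = mconst (?H * fact (n - m) / fact m) * alternant m s"
  proof (cases "inj_on s {..<m}")
    case True
    then show ?thesis
      using card_permutations_extending[OF True s]
      by (simp only: sum_constant mult.assoc[symmetric] mconst_of_nat[symmetric] mconst_mult[symmetric]
          of_nat_fact) (simp add: mult.commute)
  qed (simp add: alternant_not_inj)
  finally show ?thesis .
qed

text \<open>
  On products of orthogonal polynomials, integration against \<open>reproducing_sum\<close> is a multiple of the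
  antisymmetrizer, hence so it is on their span; on antisymmetric polynomials the antisymmetrizer
  is multiplication by \<open>m!\<close>.
\<close>

lemma int_y_reproducing_sum:
  assumes mn: "m \<le> n" and f: "f \<in> antisym_space n m"
  shows "int_y L m (in_y m f * reproducing_sum n m) =
    mconst ((\<Prod>k<n. L (p k * p k)) * fact (n - m)) * f"
proof -
  let ?c = "(\<Prod>k<n. L (p k * p k)) * fact (n - m)" and ?E = "{..<m} \<rightarrow>\<^sub>E {..<n}"
  obtain a where a: "f = (\<Sum>s\<in>?E. mconst (a s) * basis_product m s)"
    using basis_products_span[of f m n] f by (auto simp: antisym_space_def)
  have "int_y L m (in_y m f * reproducing_sum n m) =
      (\<Sum>s\<in>?E. mconst (a s) * int_y L m (in_y m (basis_product m s) * reproducing_sum n m))"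
    by (simp add: a in_y_sum in_y_mult sum_distrib_right int_y_sum mult.assoc int_y_mult_left)
  also have "\<dots> = (\<Sum>s\<in>?E. mconst (a s) * (mconst (?c / fact m) * antisymmetrize m (basis_product m s)))"
  proof (intro sum.cong refl)
    fix s assume "s \<in> ?E"
    then have "s b < n" if "b < m" for b using that by auto
    then show "mconst (a s) * int_y L m (in_y m (basis_product m s) * reproducing_sum n m) =
        mconst (a s) * (mconst (?c / fact m) * antisymmetrize m (basis_product m s))"
      by (simp only: int_y_basis_product_reproducing_sum[OF mn] antisymmetrize_basis_product)
  qed
  also have "\<dots> = mconst (?c / fact m) * antisymmetrize m f"
    by (simp only: a antisymmetrize_sum antisymmetrize_mconst_mult sum_distrib_left mult.left_commute)
  also have "antisymmetrize m f = mconst (fact m) * f"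
    using f by (intro antisymmetrize_antisymmetric) (simp add: antisym_space_def)
  also have "mconst (?c / fact m) * (mconst (fact m) * f) = mconst ?c * f"
    unfolding mult.assoc[symmetric] mconst_mult[symmetric] by simp
  finally show ?thesis .
qed

lemma vandermondes_times_integral:
  assumes "m \<le> n"
  shows "vandermonde m * in_y m (vandermonde m) *
      fold (int_var L) [2 * m..<m + n] (symmetric_integrand m n) = reproducing_sum n m"
proof -
  have "mvars (vandermonde m * in_y m (vandermonde m)) \<subseteq> {..<m} \<union> {m..<2 * m}"
    using mvars_mult mvars_vandermonde mvars_in_y[OF mvars_vandermonde] by blast
  then have "mvars (vandermonde m * in_y m (vandermonde m)) \<inter> set [2 * m..<m + n] = {}"
    by auto
  from fold_int_var_mult_left[OF this] show ?thesis
    unfolding reproducing_sum_def integrated_vandermonde_product[OF assms, symmetric]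
      vandermonde_product_factorization[OF assms] by simp
qed

theorem CD_kernel_eq_integral:
  assumes mn: "m \<le> n"
  shows "CD_kernel L n m = mconst (1 / ((\<Prod>k<n. L (p k * p k)) * fact (n - m))) *
    fold (int_var L) [2 * m..<m + n] (symmetric_integrand m n)"
    (is "_ = mconst (1 / ?c) * ?F")
proof (rule CD_kernel_eqI)
  have c: "?c \<noteq> 0" using norm_nz by simp
  show "mvars (mconst (1 / ?c) * ?F) \<subseteq> {..<2 * m}"
  proof -
    have "mvars ?F \<subseteq> {..<2 * m}"
      using mvars_fold_int_var[of L "[2 * m..<m + n]" "symmetric_integrand m n"]
        mvars_symmetric_integrand[of m n] by fastforce
    then show ?thesis using mvars_mult[of "mconst (1 / ?c)" ?F] by simp
  qed
  have eq: "vandermonde m * in_y m (vandermonde m) * (mconst (1 / ?c) * ?F) =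
      mconst (1 / ?c) * reproducing_sum n m"
    by (simp only: vandermondes_times_integral[OF mn, symmetric] mult.left_commute)
  have "f = int_y L m (in_y m f * (mconst (1 / ?c) * reproducing_sum n m))"
    if "f \<in> antisym_space n m" for f
  proof -
    have "int_y L m (in_y m f * (mconst (1 / ?c) * reproducing_sum n m)) =
        mconst (1 / ?c) * int_y L m (in_y m f * reproducing_sum n m)"
      by (simp only: mult.left_commute[of "in_y m f"]) (simp only: int_y_mult_left mvars_mconst empty_subsetI)
    also have "\<dots> = mconst (1 / ?c * ?c) * f"
      by (simp only: int_y_reproducing_sum[OF mn that] mconst_mult mult.assoc)
    also have "1 / ?c * ?c = 1" by (simp only: times_divide_eq_left mult_1_left divide_self[OF c])
    finally show ?thesis by simp
  qed
  then show "is_reproducing_kernel L n m (vandermonde m * in_y m (vandermonde m) * (mconst (1 / ?c) * ?F))"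
    unfolding eq is_reproducing_kernel_def using reproducing_sum_in_antisym_tensor[OF mn] by blast
qed

end

text \<open>
  The orthogonal polynomials only serve to prove the integral formula and to name its constant.
  The formula itself is symmetric, because a permutation of the first \<open>2 * m\<close> variables fixes the
  integrand and leaves the integration variables alone.
\<close>

theorem corollary1:
  fixes L :: "complex poly \<Rightarrow> complex" and m n :: nat
  assumes "Vector_Spaces.linear smult (*) L"
    and "nondegenerate_pairing L"
    and "m \<le> n"
  shows "symmetric_in (2 * m) (CD_kernel L n m)"
proof -
  interpret orthogonal_system L "orth_poly L"
    using assms(1,2) by (rule orthogonal_system_orth_poly)
  show ?thesis
    unfolding symmetric_in_def
  proof (intro allI impI)
    fix \<sigma> :: "nat \<Rightarrow> nat" assume \<sigma>: "\<sigma> permutes {..<2 * m}"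
    have "\<sigma> i = i" if "i \<in> set [2 * m..<m + n]" for i
      using permutes_not_in[OF \<sigma>] that by simp
    then show "rename_vars \<sigma> (CD_kernel L n m) = CD_kernel L n m"
      unfolding CD_kernel_eq_integral[OF assms(3)] rename_vars_mult rename_vars_mconst
      by (simp only: rename_vars_fold_int_var[OF permutes_inj[OF \<sigma>]] rename_vars_symmetric_integrand[OF \<sigma>])
  qed
qed

end
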